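(* Let $V$ be a finite-dimensional irreducible $\mathcal{A}$-module, let $\xi,\xi^{*},\xi^{\varepsilon}\in\mathbb{K}$ be nonzero scalars, and let $A,A^{*},A^{\varepsilon}$ be the actions on $V$ of $\xi x,\xi^{*}y,\xi^{\varepsilon}z$ respectively. Then $A,A^{*},A^{\varepsilon}$ is a Leonard triple on $V$ of Bannai/Ito type. If $V$ is of type $B$ then $A,A^{*},A^{\varepsilon}$ is totally bipartite. If $V$ is of type $AB$ then $A,A^{*},A^{\varepsilon}$ is totally almost bipartite.
   Context: $\mathbb{K}$ is an algebraically closed field of characteristic zero. $\mathcal{A}$ is the unital associative $\mathbb{K}$-algebra with generators $x,y,z$ and relations $xy+yx=2z$, $yz+zy=2x$, $zx+xz=2y$. Type $B(d)$ ($d\ge 0$ even): an $\mathcal{A}$-module is of type $B(d)$ if it is isomorphic to the irreducible module with basis $\{v_i\}_{i=0}^d$ and, for $0\le i\le d$: $x.v_i=(-1)^i(d-2i)v_i$, $y.v_i=(d-i+1)v_{i-1}+(i+1)v_{i+1}$, $z.v_i=(-1)^{i-1}(d-i+1)v_{i-1}+(-1)^i(i+1)v_{i+1}$, with $v_{-1}=0=v_{d+1}$. Type $AB(d,n)$ ($d\ge 0$ an integer, $n\in\{0,x,y,z\}$): for $a\in\{x,y,z\}$ put $\widehat a(n)=1$ if $n\in\{0,a\}$ and $\widehat a(n)=-1$ otherwise. An $\mathcal{A}$-module is of type $AB(d,n)$ if it is isomorphic to the irreducible module with basis $\{v_i\}_{i=0}^d$ and, for $0\le i\le d$: $x.v_i=\widehat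 x(n)(-1)^{d+i}(2d-2i+1)v_i$, $y.v_i=\widehat y(n)(-1)^d\big((2d-i+2)v_{i-1}+(i+1)v_{i+1}\big)$, $z.v_i=\widehat z(n)\big((-1)^{i-1}(2d-i+2)v_{i-1}+(-1)^i(i+1)v_{i+1}\big)$, with $v_{-1}=0$, $v_{d+1}=v_d$. A module is of type $B$ if it is of type $B(d)$ for some even $d\ge0$, and of type $AB$ if it is of type $AB(d,n)$ for some $d\ge 0$, $n\in\{0,x,y,z\}$. (Every finite-dimensional irreducible $\mathcal{A}$-module is of exactly one of these types.) A tridiagonal matrix is irreducible if every subdiagonal and superdiagonal entry is nonzero. A tridiagonal matrix $B$ indexed by $0,\dots,d$ is bipartite if $B_{ii}=0$ for all $i$; it is almost bipartite if exactly one of $B_{00},B_{dd}$ is nonzero and $B_{ii}=0$ for $1\le i\le d-1$ (for $d=0$ this means $B_{00}\neq0$). A Leonard pair on a $\mathbb{K}$-vector space $V$ of dimension $d+1\ge1$ is an ordered pair of linear maps $A,A^*:V\to V$ such that there is a basis $\{v_i\}_{i=0}^d$ in which $A$ is diagonal and $A^*$ is irreducible tridiagonal, and a basis $\{v_i^*\}_{i=0}^d$ in which $A^*$ is diagonal and $A$ is irreducible tridiagonal. With $\theta_i,\theta_i^*$ the eigenvalues of $A,A^*$ for $v_i,v_i^*$ respectively, the Leonard pair is of Bannai/Ito type if $\frac{\theta_{i-2}-\theta_{i+1}}{\theta_{i-1}-\theta_i}=\frac{\theta^*_{i-2}-\theta^*_{i+1}}{\theta^*_{i-1}-\theta^*_i}=-1$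 for $2\le i\le d-1$ (vacuous when $d\le2$). A Leonard triple on $V$ is an ordered triple of linear maps $A,A^*,A^\varepsilon:V\to V$ such that for each of the three maps there is a basis of $V$ in which that map is diagonal and the other two are irreducible tridiagonal. It is totally bipartite (resp. totally almost bipartite) if all six tridiagonal matrices so arising are bipartite (resp. almost bipartite). Any two of the three maps (in either order) form a Leonard pair; the triple is of Bannai/Ito type if all these Leonard pairs are. *)

theory Defs
  imports "HOL-Library.Poly_Mapping" "HOL-Computational_Algebra.Polynomial"
begin

section \<open>The algebra \<open>\<A>\<close> by generators and relations\<close>

datatype gen = GX | GY | GZ

text \<open>
  Words in the generators, written additively so that \<open>word \<Rightarrow>\<^sub>0 'k\<close>, with its convolution
  product, is the free unital associative algebra on three generators.
\<close>

datatype word = Word (letters: "gen list")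

instantiation word :: monoid_add
begin

definition "0 = Word []"
definition "u + v = Word (letters u @ letters v)"

instance by standard (simp_all add: zero_word_def plus_word_def)

end

abbreviation fgen :: "gen \<Rightarrow> word \<Rightarrow>\<^sub>0 'k::field"
  where "fgen g \<equiv> Poly_Mapping.single (Word [g]) 1"

text \<open>The two-sided ideal generated by the defining relations.\<close>

inductive_set rel_ideal :: "(word \<Rightarrow>\<^sub>0 'k::field) set" where
  zero: "0 \<in> rel_ideal"
| rel_xy: "fgen GX * fgen GY + fgen GY * fgen GX - 2 * fgen GZ \<in> rel_ideal"
| rel_yz: "fgen GY * fgen GZ + fgen GZ * fgen GY - 2 * fgen GX \<in> rel_ideal"
| rel_zx: "fgen GZ * fgen GX + fgen GX * fgen GZ - 2 * fgen GY \<in> rel_ideal"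
| add: "f \<in> rel_ideal \<Longrightarrow> g \<in> rel_ideal \<Longrightarrow> f + g \<in> rel_ideal"
| mult_left: "f \<in> rel_ideal \<Longrightarrow> h * f \<in> rel_ideal"
| mult_right: "f \<in> rel_ideal \<Longrightarrow> f * h \<in> rel_ideal"

lemma rel_ideal_uminus: "f \<in> rel_ideal \<Longrightarrow> - f \<in> rel_ideal"
  using rel_ideal.mult_left[of f "-1"] by simp

lemma rel_ideal_diff: "f \<in> rel_ideal \<Longrightarrow> g \<in> rel_ideal \<Longrightarrow> f - g \<in> rel_ideal"
  using rel_ideal.add[of f "- g"] rel_ideal_uminus[of g] by simp

lemma word_add_eq_0_iff: "(0 = u + v) \<longleftrightarrow> u = 0 \<and> v = (0::word)"
  by (cases u; cases v) (auto simp: zero_word_def plus_word_def)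

lemma lookup_times_0:
  fixes f g :: "word \<Rightarrow>\<^sub>0 'k::field"
  shows "Poly_Mapping.lookup (f * g) 0 = Poly_Mapping.lookup f 0 * Poly_Mapping.lookup g 0"
proof -
  let ?f = "Poly_Mapping.lookup f" and ?g = "Poly_Mapping.lookup g"
  have *: "Sum_any (\<lambda>q. ?g q when 0 = l + q) = (?g 0 when l = 0)" for l
  proof -
    have "(\<lambda>q. ?g q when 0 = l + q) = (\<lambda>q. (?g q when q = 0) when l = 0)"
      by (auto simp: word_add_eq_0_iff when_def)
    then show ?thesis
      by (simp only: Sum_any_when_independent Sum_any_when_equal)
  qed
  have "Poly_Mapping.lookup (f * g) 0 = Sum_any (\<lambda>l. ?f l * ?g 0 when l = 0)"
    by (simp only: lookup_mult * mult_when)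
  then show ?thesis
    by simp
qed

lemma lookup_fgen_0: "Poly_Mapping.lookup (fgen g) 0 = 0"
  by (simp add: lookup_single zero_word_def when_def)

lemma lookup_rel_ideal_0: "f \<in> rel_ideal \<Longrightarrow> Poly_Mapping.lookup f 0 = 0"
  by (induction rule: rel_ideal.induct)
     (simp_all add: lookup_add lookup_minus lookup_times_0 lookup_fgen_0)

lemma one_notin_rel_ideal: "(1 :: word \<Rightarrow>\<^sub>0 'k::field) \<notin> rel_ideal"
  using lookup_rel_ideal_0[of "1 :: word \<Rightarrow>\<^sub>0 'k"] by (auto simp: lookup_one)

quotient_type (overloaded) 'k spin_alg = "word \<Rightarrow>\<^sub>0 'k::field" / "\<lambda>f g. f - g \<in> rel_ideal"
proof (rule equivpI)
  show "reflp (\<lambda>f g :: word \<Rightarrow>\<^sub>0 'k. f - g \<in> rel_ideal)"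
    by (simp add: reflp_def rel_ideal.zero)
  show "symp (\<lambda>f g :: word \<Rightarrow>\<^sub>0 'k. f - g \<in> rel_ideal)"
    by (rule sympI) (metis rel_ideal_uminus minus_diff_eq)
  show "transp (\<lambda>f g :: word \<Rightarrow>\<^sub>0 'k. f - g \<in> rel_ideal)"
    by (rule transpI) (metis rel_ideal.add diff_add_cancel add_diff_eq)
qed

instantiation spin_alg :: (field) ring_1
begin

lift_definition zero_spin_alg :: "'a spin_alg" is 0 .

lift_definition one_spin_alg :: "'a spin_alg" is 1 .

lift_definition plus_spin_alg :: "'a spin_alg \<Rightarrow> 'a spin_alg \<Rightarrow> 'a spin_alg" is "(+)"
  using rel_ideal.add by (fastforce simp: algebra_simps)

lift_definition minus_spin_alg :: "'a spin_alg \<Rightarrow> 'a spin_alg \<Rightarrow> 'a spin_alg" is "(-)"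
  using rel_ideal_diff by (fastforce simp: algebra_simps)

lift_definition uminus_spin_alg :: "'a spin_alg \<Rightarrow> 'a spin_alg" is uminus
  using rel_ideal_uminus by (fastforce simp: algebra_simps)

lift_definition times_spin_alg :: "'a spin_alg \<Rightarrow> 'a spin_alg \<Rightarrow> 'a spin_alg" is "(*)"
proof -
  fix f f' g g' :: "word \<Rightarrow>\<^sub>0 'a"
  assume "f - f' \<in> rel_ideal" and "g - g' \<in> rel_ideal"
  then have "(f - f') * g + f' * (g - g') \<in> rel_ideal"
    by (intro rel_ideal.add rel_ideal.mult_right rel_ideal.mult_left)
  then show "f * g - f' * g' \<in> rel_ideal"
    by (simp add: algebra_simps)
qed

instance
proof
  show "(0::'a spin_alg) \<noteq> 1"
    by transfer (use one_notin_rel_ideal rel_ideal_uminus in force)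
qed (transfer; simp add: algebra_simps rel_ideal.zero)+

end

text \<open>The structure map of the \<open>'k\<close>-algebra \<open>\<A>\<close>.\<close>

lift_definition scalar :: "'k::field \<Rightarrow> 'k spin_alg" is "Poly_Mapping.single 0" .

lift_definition x_gen :: "'k::field spin_alg" is "fgen GX" .
lift_definition y_gen :: "'k::field spin_alg" is "fgen GY" .
lift_definition z_gen :: "'k::field spin_alg" is "fgen GZ" .

lemma spin_alg_relations:
  shows "x_gen * y_gen + y_gen * x_gen = (2 :: 'k::field spin_alg) * z_gen"
    and "y_gen * z_gen + z_gen * y_gen = (2 :: 'k::field spin_alg) * x_gen"
    and "z_gen * x_gen + x_gen * z_gen = (2 :: 'k::field spin_alg) * y_gen"
proof -
  show "x_gen * y_gen + y_gen * x_gen = (2 :: 'k spin_alg) * z_gen"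
    unfolding mult_2 by transfer (rule rel_ideal.rel_xy[unfolded mult_2])
  show "y_gen * z_gen + z_gen * y_gen = (2 :: 'k spin_alg) * x_gen"
    unfolding mult_2 by transfer (rule rel_ideal.rel_yz[unfolded mult_2])
  show "z_gen * x_gen + x_gen * z_gen = (2 :: 'k spin_alg) * y_gen"
    unfolding mult_2 by transfer (rule rel_ideal.rel_zx[unfolded mult_2])
qed


section \<open>Ordered bases, matrices, Leonard pairs and triples\<close>

text \<open>The vectors \<open>v 0, \<dots>, v d\<close> form a basis; values of \<open>v\<close> beyond \<open>d\<close> are irrelevant.\<close>

definition ordered_basis ::
  "('k::field \<Rightarrow> 'v::ab_group_add \<Rightarrow> 'v) \<Rightarrow>
   nat \<Rightarrow> (nat \<Rightarrow> 'v) \<Rightarrow> bool" where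
  "ordered_basis scale d v \<longleftrightarrow>
     inj_on v {0..d} \<and> \<not> module.dependent scale (v ` {0..d}) \<and>
     module.span scale (v ` {0..d}) = UNIV"

text \<open>Column convention: \<open>T (v j) = (\<Sum>i\<le>d. matrix_wrt scale d v T i j \<cdot> v i)\<close>.\<close>

definition matrix_wrt ::
  "('k::field \<Rightarrow> 'v::ab_group_add \<Rightarrow> 'v) \<Rightarrow>
   nat \<Rightarrow> (nat \<Rightarrow> 'v) \<Rightarrow> ('v \<Rightarrow> 'v) \<Rightarrow> nat \<Rightarrow> nat \<Rightarrow> 'k" where
  "matrix_wrt scale d v T i j = module.representation scale (v ` {0..d}) (T (v j)) (v i)"

definition diagonal_matrix :: "nat \<Rightarrow> (nat \<Rightarrow> nat \<Rightarrow> 'k::zero) \<Rightarrow> bool" where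
  "diagonal_matrix d M \<longleftrightarrow> (\<forall>i\<le>d. \<forall>j\<le>d. i \<noteq> j \<longrightarrow> M i j = 0)"

definition irreducible_tridiagonal :: "nat \<Rightarrow> (nat \<Rightarrow> nat \<Rightarrow> 'k::zero) \<Rightarrow> bool" where
  "irreducible_tridiagonal d M \<longleftrightarrow>
     (\<forall>i\<le>d. \<forall>j\<le>d. (i > j + 1 \<or> j > i + 1) \<longrightarrow> M i j = 0) \<and>
     (\<forall>i<d. M i (i + 1) \<noteq> 0 \<and> M (i + 1) i \<noteq> 0)"

text \<open>The next two are meant for tridiagonal matrices.\<close>

definition bipartite_matrix :: "nat \<Rightarrow> (nat \<Rightarrow> nat \<Rightarrow> 'k::zero) \<Rightarrow> bool" where
  "bipartite_matrix d M \<longleftrightarrow> (\<forall>i\<le>d. M i i = 0)"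

text \<open>For \<open>d = 0\<close> the first conjunct reads \<open>M 0 0 \<noteq> 0\<close>.\<close>

definition almost_bipartite_matrix :: "nat \<Rightarrow> (nat \<Rightarrow> nat \<Rightarrow> 'k::zero) \<Rightarrow> bool" where
  "almost_bipartite_matrix d M \<longleftrightarrow>
     (\<exists>!i. i \<in> {0, d} \<and> M i i \<noteq> 0) \<and> (\<forall>i. 0 < i \<and> i < d \<longrightarrow> M i i = 0)"

definition leonard_basis ::
  "('k::field \<Rightarrow> 'v::ab_group_add \<Rightarrow> 'v) \<Rightarrow>
   nat \<Rightarrow> (nat \<Rightarrow> 'v) \<Rightarrow> ('v \<Rightarrow> 'v) \<Rightarrow> ('v \<Rightarrow> 'v) \<Rightarrow> bool" where
  "leonard_basis scale d v A B \<longleftrightarrow>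
     ordered_basis scale d v \<and> diagonal_matrix d (matrix_wrt scale d v A) \<and>
     irreducible_tridiagonal d (matrix_wrt scale d v B)"

definition leonard_pair ::
  "('k::field \<Rightarrow> 'v::ab_group_add \<Rightarrow> 'v) \<Rightarrow>
   ('v \<Rightarrow> 'v) \<Rightarrow> ('v \<Rightarrow> 'v) \<Rightarrow> bool" where
  "leonard_pair scale A B \<longleftrightarrow>
     Vector_Spaces.linear scale scale A \<and> Vector_Spaces.linear scale scale B \<and>
     (\<exists>d v w. leonard_basis scale d v A B \<and> leonard_basis scale d w B A)"

text \<open>
  The two bases of a Leonard pair are unique up to rescaling of the vectors and reversal of their
  order, and the condition below is insensitive to both; it is imposed on every choice of bases.
\<close>

definition bannai_ito_pair ::
  "('k::field \<Rightarrow> 'v::ab_group_add \<Rightarrow> 'v) \<Rightarrow>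
   ('v \<Rightarrow> 'v) \<Rightarrow> ('v \<Rightarrow> 'v) \<Rightarrow> bool" where
  "bannai_ito_pair scale A B \<longleftrightarrow> leonard_pair scale A B \<and>
     (\<forall>d v w \<theta> \<theta>s.
        leonard_basis scale d v A B \<and> leonard_basis scale d w B A \<and>
        (\<forall>i\<le>d. A (v i) = scale (\<theta> i) (v i)) \<and> (\<forall>i\<le>d. B (w i) = scale (\<theta>s i) (w i)) \<longrightarrow>
        (\<forall>i. 2 \<le> i \<and> i \<le> d - 1 \<longrightarrow>
           (\<theta> (i - 2) - \<theta> (i + 1)) / (\<theta> (i - 1) - \<theta> i) = -1 \<and>
           (\<theta>s (i - 2) - \<theta>s (i + 1)) / (\<theta>s (i - 1) - \<theta>s i) = -1))"

definition leonard_triple_basis ::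
  "('k::field \<Rightarrow> 'v::ab_group_add \<Rightarrow> 'v) \<Rightarrow>
   nat \<Rightarrow> (nat \<Rightarrow> 'v) \<Rightarrow> ('v \<Rightarrow> 'v) \<Rightarrow> ('v \<Rightarrow> 'v) \<Rightarrow> ('v \<Rightarrow> 'v) \<Rightarrow> bool" where
  "leonard_triple_basis scale d v A B C \<longleftrightarrow>
     ordered_basis scale d v \<and> diagonal_matrix d (matrix_wrt scale d v A) \<and>
     irreducible_tridiagonal d (matrix_wrt scale d v B) \<and>
     irreducible_tridiagonal d (matrix_wrt scale d v C)"

definition leonard_triple ::
  "('k::field \<Rightarrow> 'v::ab_group_add \<Rightarrow> 'v) \<Rightarrow>
   ('v \<Rightarrow> 'v) \<Rightarrow> ('v \<Rightarrow> 'v) \<Rightarrow> ('v \<Rightarrow> 'v) \<Rightarrow> bool" where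
  "leonard_triple scale A B C \<longleftrightarrow>
     Vector_Spaces.linear scale scale A \<and> Vector_Spaces.linear scale scale B \<and>
     Vector_Spaces.linear scale scale C \<and>
     (\<exists>d u v w. leonard_triple_basis scale d u A B C \<and> leonard_triple_basis scale d v B C A \<and>
        leonard_triple_basis scale d w C A B)"

definition bannai_ito_triple ::
  "('k::field \<Rightarrow> 'v::ab_group_add \<Rightarrow> 'v) \<Rightarrow>
   ('v \<Rightarrow> 'v) \<Rightarrow> ('v \<Rightarrow> 'v) \<Rightarrow> ('v \<Rightarrow> 'v) \<Rightarrow> bool" where
  "bannai_ito_triple scale A B C \<longleftrightarrow> leonard_triple scale A B C \<and>
     bannai_ito_pair scale A B \<and> bannai_ito_pair scale B A \<and> bannai_ito_pair scale B C \<and>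
     bannai_ito_pair scale C B \<and> bannai_ito_pair scale C A \<and> bannai_ito_pair scale A C"

text \<open>
  All six tridiagonal matrices of a Leonard triple satisfy \<open>P\<close>, for every choice of the bases
  (which are unique up to rescaling and reversal).
\<close>

definition all_tridiagonals ::
  "('k::field \<Rightarrow> 'v::ab_group_add \<Rightarrow> 'v) \<Rightarrow>
   (nat \<Rightarrow> (nat \<Rightarrow> nat \<Rightarrow> 'k) \<Rightarrow> bool) \<Rightarrow> ('v \<Rightarrow> 'v) \<Rightarrow> ('v \<Rightarrow> 'v) \<Rightarrow> ('v \<Rightarrow> 'v) \<Rightarrow> bool" where
  "all_tridiagonals scale P A B C \<longleftrightarrow>
     (\<forall>d v. leonard_triple_basis scale d v A B C \<longrightarrow>
        P d (matrix_wrt scale d v B) \<and> P d (matrix_wrt scale d v C)) \<and>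
     (\<forall>d v. leonard_triple_basis scale d v B C A \<longrightarrow>
        P d (matrix_wrt scale d v C) \<and> P d (matrix_wrt scale d v A)) \<and>
     (\<forall>d v. leonard_triple_basis scale d v C A B \<longrightarrow>
        P d (matrix_wrt scale d v A) \<and> P d (matrix_wrt scale d v B))"

definition totally_bipartite ::
  "('k::field \<Rightarrow> 'v::ab_group_add \<Rightarrow> 'v) \<Rightarrow>
   ('v \<Rightarrow> 'v) \<Rightarrow> ('v \<Rightarrow> 'v) \<Rightarrow> ('v \<Rightarrow> 'v) \<Rightarrow> bool" where
  "totally_bipartite scale A B C \<longleftrightarrow>
     leonard_triple scale A B C \<and> all_tridiagonals scale bipartite_matrix A B C"

definition totally_almost_bipartite ::
  "('k::field \<Rightarrow> 'v::ab_group_add \<Rightarrow> 'v) \<Rightarrow>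
   ('v \<Rightarrow> 'v) \<Rightarrow> ('v \<Rightarrow> 'v) \<Rightarrow> ('v \<Rightarrow> 'v) \<Rightarrow> bool" where
  "totally_almost_bipartite scale A B C \<longleftrightarrow>
     leonard_triple scale A B C \<and> all_tridiagonals scale almost_bipartite_matrix A B C"


section \<open>Modules over \<open>\<A>\<close>\<close>

text \<open>
  The \<open>'k\<close>-vector space structure on the module is the one induced by the action of \<open>\<A>\<close>.
\<close>

locale spin_module = vector_space scale
  for scale :: "'k::field \<Rightarrow> 'v::ab_group_add \<Rightarrow> 'v" +
  fixes act :: "'k spin_alg \<Rightarrow> 'v \<Rightarrow> 'v"
  assumes act_linear: "Vector_Spaces.linear scale scale (act a)"
    and act_add: "act (a + b) v = act a v + act b v"
    and act_mult: "act (a * b) v = act a (act b v)"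
    and act_one: "act 1 v = v"
    and act_scalar: "act (scalar c) v = scale c v"
begin

definition submodule :: "'v set \<Rightarrow> bool" where
  "submodule W \<longleftrightarrow> subspace W \<and> (\<forall>a. \<forall>w\<in>W. act a w \<in> W)"

definition irreducible_module :: bool where
  "irreducible_module \<longleftrightarrow>
     (UNIV :: 'v set) \<noteq> {0} \<and> (\<forall>W. submodule W \<longrightarrow> W = {0} \<or> W = UNIV)"

definition fin_dim :: bool where
  "fin_dim \<longleftrightarrow> (\<exists>B. finite B \<and> span B = UNIV)"

end

text \<open>\<open>v\<^bsub>i-1\<^esub>\<close>, with \<open>v\<^bsub>-1\<^esub> = 0\<close>.\<close>

definition pred_vec :: "(nat \<Rightarrow> 'v::zero) \<Rightarrow> nat \<Rightarrow> 'v" where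
  "pred_vec v i = (if i = 0 then 0 else v (i - 1))"

text \<open>\<open>v\<^bsub>i+1\<^esub>\<close> for \<open>i \<le> d\<close>, with \<open>v\<^bsub>d+1\<^esub>\<close> replaced by \<open>e\<close>.\<close>

definition succ_vec :: "nat \<Rightarrow> 'v \<Rightarrow> (nat \<Rightarrow> 'v) \<Rightarrow> nat \<Rightarrow> 'v" where
  "succ_vec d e v i = (if i = d then e else v (i + 1))"

text \<open>The sign hat-\<open>a(n)\<close>; \<open>None\<close> stands for \<open>n = 0\<close> and \<open>Some a\<close> for \<open>n = a\<close>.\<close>

definition hat_sign :: "gen \<Rightarrow> gen option \<Rightarrow> 'k::ring_1" where
  "hat_sign a n = (if n = None \<or> n = Some a then 1 else -1)"

text \<open>
  A module is isomorphic to one given by the action on a basis iff it has itself a basis with that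
  action. The sign \<open>(-1)\<^bsup>i-1\<^esup>\<close> is written \<open>(-1)\<^bsup>i+1\<^esup>\<close> to avoid truncated subtraction at \<open>i = 0\<close>.
\<close>

context spin_module
begin

definition type_Bd :: "nat \<Rightarrow> bool" where
  "type_Bd d \<longleftrightarrow> even d \<and>
     (\<exists>v. ordered_basis scale d v \<and>
       (\<forall>i\<le>d.
          act x_gen (v i) = scale ((-1) ^ i * (of_nat d - 2 * of_nat i)) (v i) \<and>
          act y_gen (v i) =
            scale (of_nat d - of_nat i + 1) (pred_vec v i) +
            scale (of_nat i + 1) (succ_vec d 0 v i) \<and>
          act z_gen (v i) =
            scale ((-1) ^ (i + 1) * (of_nat d - of_nat i + 1)) (pred_vec v i) +
            scale ((-1) ^ i * (of_nat i + 1)) (succ_vec d 0 v i)))"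

definition type_ABdn :: "nat \<Rightarrow> gen option \<Rightarrow> bool" where
  "type_ABdn d n \<longleftrightarrow>
     (\<exists>v. ordered_basis scale d v \<and>
       (\<forall>i\<le>d.
          act x_gen (v i) =
            scale (hat_sign GX n * (-1) ^ (d + i) * (2 * of_nat d - 2 * of_nat i + 1)) (v i) \<and>
          act y_gen (v i) =
            scale (hat_sign GY n * (-1) ^ d)
              (scale (2 * of_nat d - of_nat i + 2) (pred_vec v i) +
               scale (of_nat i + 1) (succ_vec d (v d) v i)) \<and>
          act z_gen (v i) =
            scale (hat_sign GZ n)
              (scale ((-1) ^ (i + 1) * (2 * of_nat d - of_nat i + 2)) (pred_vec v i) +
               scale ((-1) ^ i * (of_nat i + 1)) (succ_vec d (v d) v i))))"

definition type_B :: bool where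
  "type_B \<longleftrightarrow> (\<exists>d. type_Bd d)"

definition type_AB :: bool where
  "type_AB \<longleftrightarrow> (\<exists>d n. type_ABdn d n)"

end

end

theory Submission
  imports Defs
begin

text \<open>
  Put \<open>R = y + z\<close> and \<open>L = y - z\<close>. The relations say \<open>xR = R(2 - x)\<close> and \<open>xL = L(-2 - x)\<close>, so \<open>R\<close> and
  \<open>L\<close> act on the eigenvalues of \<open>x\<close> by the reflections \<open>\<theta> \<mapsto> 2 - \<theta>\<close> and \<open>\<theta> \<mapsto> -2 - \<theta>\<close>. On an irreducible
  module the central element \<open>x\<^sup>2 + y\<^sup>2 + z\<^sup>2\<close> is a scalar, hence \<open>R\<^sup>2\<close> and \<open>L\<^sup>2\<close> are scalars on each
  eigenspace of \<open>x\<close>. Applying \<open>L\<close> and \<open>R\<close> alternately to a vector at an end of the chain of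
  eigenvalues (one fixed by a reflection, or one killed by \<open>R\<close> or \<open>L\<close>) gives an eigenbasis of \<open>x\<close> with
  distinct eigenvalues, in which \<open>y\<close> and \<open>z\<close> are irreducible tridiagonal; the cyclic symmetry of the
  relations does the same for \<open>y\<close> and \<open>z\<close>.

  The relation \<open>x\<^sup>2y + 2xyx + yx\<^sup>2 = 4y\<close> forces \<open>\<theta> i + \<theta> j = \<plusminus>2\<close> wherever the \<open>(i, j)\<close> entry of \<open>y\<close> is nonzero.
  Distinctness of the eigenvalues makes the signs alternate along the diagonal, which is the
  Bannai/Ito condition, and leaves room for at most one nonzero diagonal entry, at an end. So the
  matrix is bipartite or almost bipartite according to whether its trace vanishes, and the trace can
  be read off from any basis.
\<close>

section \<open>Coordinates and traces\<close>

definition coord ::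
  "('k::field \<Rightarrow> 'v::ab_group_add \<Rightarrow> 'v) \<Rightarrow> nat \<Rightarrow> (nat \<Rightarrow> 'v) \<Rightarrow> 'v \<Rightarrow> nat \<Rightarrow> 'k" where
  "coord scale d v x i = module.representation scale (v ` {0..d}) x (v i)"

context vector_space
begin

lemma linear_addD: "Vector_Spaces.linear scale scale T \<Longrightarrow> T (u + v) = T u + T v"
  and linear_scaleD: "Vector_Spaces.linear scale scale T \<Longrightarrow> T (scale c v) = scale c (T v)"
  and linear_sumD: "Vector_Spaces.linear scale scale T \<Longrightarrow> T (sum f S) = (\<Sum>i\<in>S. T (f i))"
  using module_hom.add module_hom.scale module_hom.sum
  unfolding module_hom_iff_linear[symmetric] by metis+

lemma linear_zeroD: "Vector_Spaces.linear scale scale T \<Longrightarrow> T 0 = 0"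
  using linear_scaleD[of T 0 0] by simp

lemma linear_minusD: "Vector_Spaces.linear scale scale T \<Longrightarrow> T (- v) = - T v"
  using linear_scaleD[of T "-1" v] by simp

lemma linear_diffD: "Vector_Spaces.linear scale scale T \<Longrightarrow> T (u - v) = T u - T v"
  using linear_addD[of T u "- v"] linear_minusD[of T v] by simp

lemma linearI:
  assumes "\<And>u v. T (u + v) = T u + T v" and "\<And>c v. T (scale c v) = scale c (T v)"
  shows "Vector_Spaces.linear scale scale T"
  using assms vector_space_axioms unfolding Vector_Spaces.linear_iff by blast

lemma linear_minus: "Vector_Spaces.linear scale scale T \<Longrightarrow> Vector_Spaces.linear scale scale (\<lambda>v. - T v)"
  by (rule linearI) (simp_all add: linear_addD linear_scaleD)

text \<open>Treating the vectors as an indexed family makes injectivity part of the conclusion: a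
  repetition \<open>v i = v j\<close> would already be the nontrivial relation
  \<open>v i - v j = 0\<close>.\<close>

lemma independent_family:
  assumes "finite I" and zero: "\<And>c. (\<Sum>i\<in>I. scale (c i) (v i)) = 0 \<Longrightarrow> \<forall>i\<in>I. c i = 0"
  shows "inj_on v I \<and> independent (v ` I)"
proof
  show inj: "inj_on v I"
  proof (rule inj_onI, rule ccontr)
    fix i j assume ij: "i \<in> I" "j \<in> I" "v i = v j" "i \<noteq> j"
    define c :: "'c \<Rightarrow> 'a" where "c k = (if k = i then 1 else 0) - (if k = j then 1 else 0)" for k
    have "(\<Sum>k\<in>I. scale (c k) (v k)) =
        (\<Sum>k\<in>I. scale (if k = i then 1 else 0) (v k)) - (\<Sum>k\<in>I. scale (if k = j then 1 else 0) (v k))"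
      unfolding c_def scale_left_diff_distrib sum_subtractf ..
    also have "\<dots> = v i - v j"
      using ij \<open>finite I\<close> by (simp add: if_distrib[of "\<lambda>a. scale a _"] cong: if_cong)
    finally have "c i = 0"
      using zero ij by simp
    then show False
      using ij by (simp add: c_def)
  qed
  show "independent (v ` I)"
    unfolding dependent_finite[OF finite_imageI[OF \<open>finite I\<close>]]
    using zero[of "\<lambda>i. _ (v i)"] by (auto simp: sum.reindex[OF inj])
qed

lemma eigenvectors_independent:
  assumes T: "Vector_Spaces.linear scale scale T" and "finite I" and "inj_on \<theta> I"
    and "\<And>i. i \<in> I \<Longrightarrow> v i \<noteq> 0" and "\<And>i. i \<in> I \<Longrightarrow> T (v i) = scale (\<theta> i) (v i)"
  shows "inj_on v I \<and> independent (v ` I)"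
proof (rule independent_family[OF \<open>finite I\<close>])
  fix c assume "(\<Sum>i\<in>I. scale (c i) (v i)) = 0"
  with assms(2-) show "\<forall>i\<in>I. c i = 0"
  proof (induction I arbitrary: c rule: finite_induct)
    case (insert j I)
    let ?s = "\<Sum>i\<in>I. scale (c i) (v i)"
    have s: "scale (c j) (v j) + ?s = 0"
      using insert by simp
    \<comment> \<open>Applying \<open>T - \<theta> j\<close> removes \<open>v j\<close> and
      multiplies the other coefficients by \<open>\<theta> i - \<theta> j\<close>, which leaves a
      shorter relation for the induction hypothesis.\<close>
    have "T (scale (c j) (v j) + ?s) - scale (\<theta> j) (scale (c j) (v j) + ?s) =
        (\<Sum>i\<in>I. scale (c i * (\<theta> i - \<theta> j)) (v i))"
      using insert.prems(3)
      by (simp add: linear_addD[OF T] linear_scaleD[OF T] linear_sumD[OF T] scale_right_distrib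
          scale_sum_right sum_subtractf[symmetric] algebra_simps)
    then have "(\<Sum>i\<in>I. scale (c i * (\<theta> i - \<theta> j)) (v i)) = 0"
      by (simp add: s linear_zeroD[OF T])
    then have "\<forall>i\<in>I. c i * (\<theta> i - \<theta> j) = 0"
      using insert.prems by (intro insert.IH) auto
    moreover have "\<theta> i \<noteq> \<theta> j" if "i \<in> I" for i
      using inj_onD[OF insert.prems(1), of i j] insert.hyps that by auto
    ultimately have "\<forall>i\<in>I. c i = 0"
      by simp
    moreover from this have "c j = 0"
      using s insert.prems(2)[of j] by simp
    ultimately show ?case
      by simp
  qed simp
qed

lemma matrix_wrt_eq_coord: "matrix_wrt scale d v T i j = coord scale d v (T (v j)) i"
  by (simp add: matrix_wrt_def coord_def)

context
  fixes d v
  assumes basis: "ordered_basis scale d v"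
begin

lemma basis_inj: "inj_on v {..d}"
  and basis_independent: "independent (v ` {..d})"
  and basis_span: "span (v ` {..d}) = UNIV"
  using basis by (simp_all add: ordered_basis_def atLeast0AtMost)

lemma coord_add: "coord scale d v (x + y) i = coord scale d v x i + coord scale d v y i"
  and coord_scale: "coord scale d v (scale c x) i = c * coord scale d v x i"
  and coord_zero: "coord scale d v 0 i = 0"
  using basis_independent basis_span
  by (simp_all add: coord_def atLeast0AtMost representation_add representation_scale representation_zero)

lemma coord_sum: "coord scale d v (sum f S) i = (\<Sum>j\<in>S. coord scale d v (f j) i)"
  using basis_independent basis_span
  by (simp add: coord_def atLeast0AtMost representation_sum)

lemma coord_basis: "i \<le> d \<Longrightarrow> j \<le> d \<Longrightarrow> coord scale d v (v j) i = (if i = j then 1 else 0)"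
  using basis_independent basis_inj
  by (auto simp: coord_def atLeast0AtMost representation_basis inj_on_eq_iff)

lemma expand_basis: "(\<Sum>i\<le>d. scale (coord scale d v x i) (v i)) = x"
proof -
  have "(\<Sum>b\<in>v ` {..d}. scale (representation (v ` {..d}) x b) b) = x"
    using basis_independent basis_span by (intro sum_representation_eq) auto
  then show ?thesis
    by (simp add: sum.reindex[OF basis_inj] coord_def atLeast0AtMost)
qed

lemma coord_eqI: "(\<And>i. i \<le> d \<Longrightarrow> coord scale d v x i = coord scale d v y i) \<Longrightarrow> x = y"
  by (metis (no_types, lifting) expand_basis sum.cong atMost_iff)

lemma diagonal_eigenvector:
  assumes "diagonal_matrix d (matrix_wrt scale d v T)" and "j \<le> d"
  shows "T (v j) = scale (matrix_wrt scale d v T j j) (v j)"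
  using assms by (intro coord_eqI)
    (auto simp: coord_scale coord_basis matrix_wrt_eq_coord diagonal_matrix_def)

lemma diagonal_matrixI:
  assumes "\<And>i. i \<le> d \<Longrightarrow> T (v i) = scale (\<theta> i) (v i)"
  shows "diagonal_matrix d (matrix_wrt scale d v T)"
  using assms by (auto simp: diagonal_matrix_def matrix_wrt_eq_coord coord_scale coord_basis)

lemma basis_nonzero: "i \<le> d \<Longrightarrow> v i \<noteq> 0"
  using coord_basis[of i i] coord_zero[of i] by auto

lemma coord_linear:
  assumes "Vector_Spaces.linear scale scale S"
  shows "coord scale d v (S x) i = (\<Sum>k\<le>d. matrix_wrt scale d v S i k * coord scale d v x k)"
  using assms by (subst expand_basis[of x, symmetric])
    (simp add: linear_sumD linear_scaleD coord_sum coord_scale matrix_wrt_eq_coord mult.commute)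

lemma coord_diagonal:
  assumes S: "Vector_Spaces.linear scale scale S"
    and eig: "\<And>i. i \<le> d \<Longrightarrow> S (v i) = scale (\<theta> i) (v i)" and "i \<le> d"
  shows "coord scale d v (S x) i = \<theta> i * coord scale d v x i"
proof -
  have "coord scale d v (S x) i = (\<Sum>k\<le>d. matrix_wrt scale d v S i k * coord scale d v x k)"
    by (rule coord_linear[OF S])
  also have "\<dots> = (\<Sum>k\<le>d. if k = i then \<theta> i * coord scale d v x i else 0)"
    using \<open>i \<le> d\<close> by (intro sum.cong) (auto simp: matrix_wrt_eq_coord eig coord_scale coord_basis)
  finally show ?thesis
    using \<open>i \<le> d\<close> by simp
qed

end

text \<open>Expanding each \<open>v i\<close> in \<open>w\<close> and exchanging the sums turns one
  trace into the other. The trace can thus be computed in the explicit basis of a module type and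
  used in an eigenbasis.\<close>

lemma trace_independent:
  assumes v: "ordered_basis scale d v" and w: "ordered_basis scale e w"
    and T: "Vector_Spaces.linear scale scale T"
  shows "(\<Sum>i\<le>d. matrix_wrt scale d v T i i) = (\<Sum>k\<le>e. matrix_wrt scale e w T k k)"
proof -
  have "(\<Sum>i\<le>d. coord scale d v (T (v i)) i) =
      (\<Sum>i\<le>d. \<Sum>k\<le>e. coord scale e w (v i) k * coord scale d v (T (w k)) i)"
  proof (rule sum.cong[OF refl])
    fix i
    have "coord scale d v (T (v i)) i = coord scale d v (T (\<Sum>k\<le>e. scale (coord scale e w (v i) k) (w k))) i"
      by (simp add: expand_basis[OF w])
    then show "coord scale d v (T (v i)) i = (\<Sum>k\<le>e. coord scale e w (v i) k * coord scale d v (T (w k)) i)"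
      by (simp add: linear_sumD[OF T] linear_scaleD[OF T] coord_sum[OF v] coord_scale[OF v])
  qed
  also have "\<dots> = (\<Sum>k\<le>e. \<Sum>i\<le>d. coord scale e w (v i) k * coord scale d v (T (w k)) i)"
    by (rule sum.swap)
  also have "\<dots> = (\<Sum>k\<le>e. coord scale e w (\<Sum>i\<le>d. scale (coord scale d v (T (w k)) i) (v i)) k)"
    by (simp add: coord_sum[OF w] coord_scale[OF w] mult.commute)
  finally show ?thesis
    by (simp add: expand_basis[OF v] matrix_wrt_eq_coord)
qed

lemma ordered_basis_same_length:
  assumes "ordered_basis scale d v" and "ordered_basis scale e w"
  shows "d = e"
proof -
  have "card (v ` {..d}) = card (w ` {..e})"
    using assms by (intro antisym; intro independent_span_bound[THEN conjunct2])
      (simp_all add: basis_independent basis_span)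
  then show ?thesis
    using assms by (simp add: card_image basis_inj)
qed

section \<open>Tridiagonal matrices in an eigenbasis\<close>

text \<open>Row \<open>i\<close> of \<open>T x = \<theta> x\<close> involves no coordinate beyond
  \<open>i + 1\<close>, and that one has a nonzero superdiagonal coefficient. So the zeroth
  coordinate determines all the others.\<close>

lemma tridiagonal_eigenvector_zero:
  assumes w: "ordered_basis scale d w" and T: "Vector_Spaces.linear scale scale T"
    and tri: "irreducible_tridiagonal d (matrix_wrt scale d w T)"
    and x: "T x = scale \<theta> x" "coord scale d w x 0 = 0"
  shows "x = 0"
proof -
  let ?M = "matrix_wrt scale d w T"
  have "\<forall>j\<le>i. coord scale d w x j = 0" if "i \<le> d" for i
    using that
  proof (induction i)
    case (Suc i)
    then have IH: "\<And>j. j \<le> i \<Longrightarrow> coord scale d w x j = 0"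
      by simp
    have "0 = coord scale d w (T x) i"
      using IH by (simp add: x coord_scale[OF w])
    also have "\<dots> = (\<Sum>k\<le>d. ?M i k * coord scale d w x k)"
      by (rule coord_linear[OF w T])
    also have "\<dots> = (\<Sum>k\<in>{Suc i}. ?M i k * coord scale d w x k)"
    proof (rule sum.mono_neutral_right)
      show "\<forall>k\<in>{..d} - {Suc i}. ?M i k * coord scale d w x k = 0"
      proof
        fix k assume "k \<in> {..d} - {Suc i}"
        then consider "k \<le> i" | "i + 1 < k" "k \<le> d"
          by fastforce
        then show "?M i k * coord scale d w x k = 0"
          using tri IH Suc.prems by cases (auto simp: irreducible_tridiagonal_def)
      qed
    qed (use Suc.prems in auto)
    finally have "coord scale d w x (Suc i) = 0"
      using Suc.prems tri by (simp add: irreducible_tridiagonal_def)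
    then show ?case
      using IH by (simp add: le_Suc_eq)
  qed (simp add: x)
  then show ?thesis
    by (intro coord_eqI[OF w]) (simp add: coord_zero[OF w])
qed

lemma tridiagonal_eigenvalues_distinct:
  assumes v: "ordered_basis scale d v" and w: "ordered_basis scale e w"
    and T: "Vector_Spaces.linear scale scale T"
    and tri: "irreducible_tridiagonal e (matrix_wrt scale e w T)"
    and eig: "\<And>i. i \<le> d \<Longrightarrow> T (v i) = scale (\<theta> i) (v i)"
  shows "inj_on \<theta> {..d}"
proof (rule inj_onI, rule ccontr)
  fix i j assume ij: "i \<in> {..d}" "j \<in> {..d}" "\<theta> i = \<theta> j" "i \<noteq> j"
  \<comment> \<open>The coefficients are chosen so that the zeroth \<open>w\<close>-coordinate
    cancels; this eigenvector must then vanish, although \<open>v i\<close> and \<open>v j\<close>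
    are independent.\<close>
  let ?x = "scale (coord scale e w (v j) 0) (v i) + scale (- coord scale e w (v i) 0) (v j)"
  have "?x = 0"
    using ij by (intro tridiagonal_eigenvector_zero[OF w T tri, of _ "\<theta> i"])
      (simp_all add: linear_addD[OF T] linear_scaleD[OF T] eig coord_add[OF w] coord_scale[OF w]
        scale_right_distrib mult.commute del: scale_minus_left)
  then have "coord scale d v ?x i = 0"
    by (simp add: coord_zero[OF v])
  then have "coord scale e w (v j) 0 = 0"
    using ij by (simp add: coord_add[OF v] coord_scale[OF v] coord_basis[OF v] del: scale_minus_left)
  then have "v j = 0"
    using ij by (intro tridiagonal_eigenvector_zero[OF w T tri, of _ "\<theta> j"]) (simp_all add: eig)
  then show False
    using basis_nonzero[OF v] ij by simp
qed

end

section \<open>The Bannai/Ito recurrence\<close>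

lemma signs_opposite:
  fixes a b \<kappa> :: "'k::ab_group_add"
  shows "a = \<kappa> \<or> a = - \<kappa> \<Longrightarrow> b = \<kappa> \<or> b = - \<kappa> \<Longrightarrow> a \<noteq> b \<Longrightarrow> b = - a"
  by auto

text \<open>The third operator does not occur, so all six ordered pairs of the triple are covered.
  The parameter \<open>\<kappa>\<close> absorbs the rescaling of \<open>A\<close>.\<close>

locale bannai_ito_basis = vector_space scale
  for scale :: "'k::field_char_0 \<Rightarrow> 'v::ab_group_add \<Rightarrow> 'v" +
  fixes A B :: "'v \<Rightarrow> 'v" and d :: nat and v :: "nat \<Rightarrow> 'v" and \<theta> :: "nat \<Rightarrow> 'k" and \<kappa> :: 'k
  assumes linear_A: "Vector_Spaces.linear scale scale A"
    and linear_B: "Vector_Spaces.linear scale scale B"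
    and basis: "ordered_basis scale d v"
    and eigen: "i \<le> d \<Longrightarrow> A (v i) = scale (\<theta> i) (v i)"
    and distinct: "inj_on \<theta> {..d}"
    and tridiagonal: "irreducible_tridiagonal d (matrix_wrt scale d v B)"
    and \<kappa>_nonzero: "\<kappa> \<noteq> 0"
    and cubic: "A (A (B x)) + scale 2 (A (B (A x))) + B (A (A x)) = scale (\<kappa>\<^sup>2) (B x)"
begin

abbreviation "M \<equiv> matrix_wrt scale d v B"

text \<open>In the eigenbasis, \<open>A\<close> contributes \<open>\<theta> i\<close> when it stands
  left of \<open>B\<close> and \<open>\<theta> j\<close> when it stands right. The cubic relation
  therefore multiplies the entry by
  \<open>(\<theta> i + \<theta> j)\<^sup>2 - \<kappa>\<^sup>2\<close> and gives zero.\<close>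

lemma entry_nonzero_imp:
  assumes "i \<le> d" "j \<le> d" "M i j \<noteq> 0"
  shows "\<theta> i + \<theta> j = \<kappa> \<or> \<theta> i + \<theta> j = - \<kappa>"
proof -
  have A: "coord scale d v (A x) i = \<theta> i * coord scale d v x i" for x
    using coord_diagonal[OF basis linear_A eigen \<open>i \<le> d\<close>] .
  have "coord scale d v (A (A (B (v j))) + scale 2 (A (B (A (v j)))) + B (A (A (v j)))) i =
      coord scale d v (scale (\<kappa>\<^sup>2) (B (v j))) i"
    by (simp only: cubic)
  then have "((\<theta> i + \<theta> j)\<^sup>2 - \<kappa>\<^sup>2) * M i j = 0"
    using \<open>j \<le> d\<close>
    by (simp add: coord_add[OF basis] coord_scale[OF basis] A eigen linear_scaleD[OF linear_A]
        linear_scaleD[OF linear_B] matrix_wrt_eq_coord algebra_simps power2_eq_square)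
  then show ?thesis
    using assms(3) by (simp add: power2_eq_iff)
qed

lemma consecutive_sum: "i < d \<Longrightarrow> \<theta> i + \<theta> (Suc i) = \<kappa> \<or> \<theta> i + \<theta> (Suc i) = - \<kappa>"
  using entry_nonzero_imp[of i "Suc i"] tridiagonal by (simp add: irreducible_tridiagonal_def)

lemma distinctD: "i \<le> d \<Longrightarrow> j \<le> d \<Longrightarrow> \<theta> i = \<theta> j \<Longrightarrow> i = j"
  using distinct by (auto dest: inj_onD)

text \<open>Both sums are \<open>\<kappa>\<close> or \<open>- \<kappa>\<close>, and if they were
  equal then \<open>\<theta> i\<close> would equal \<open>\<theta> (i + 2)\<close>.\<close>

lemma alternating_sums:
  assumes "Suc i < d"
  shows "\<theta> (Suc i) + \<theta> (Suc (Suc i)) = - (\<theta> i + \<theta> (Suc i))"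
proof -
  have "\<theta> i + \<theta> (Suc i) \<noteq> \<theta> (Suc i) + \<theta> (Suc (Suc i))"
    using distinctD[of i "Suc (Suc i)"] assms by auto
  then show ?thesis
    using consecutive_sum[of i] consecutive_sum[of "Suc i"] assms by (intro signs_opposite) auto
qed

lemma bannai_ito_ratio:
  assumes "2 \<le> i" "i \<le> d - 1"
  shows "(\<theta> (i - 2) - \<theta> (i + 1)) / (\<theta> (i - 1) - \<theta> i) = -1"
proof -
  obtain k where i: "i = Suc (Suc k)"
    using assms(1) by (metis Suc_le_D numeral_2_eq_2 Suc_le_mono)
  have d: "Suc (Suc k) < d"
    using assms i by linarith
  then have "\<theta> (Suc k) \<noteq> \<theta> (Suc (Suc k))"
    using distinctD[of "Suc k" "Suc (Suc k)"] by auto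
  \<comment> \<open>Of three consecutive sums the first and third agree and the middle one is their
    negative; numerator and denominator are combinations of these.\<close>
  moreover have "\<theta> k - \<theta> (Suc (Suc (Suc k))) = - (\<theta> (Suc k) - \<theta> (Suc (Suc k)))"
    using alternating_sums[of k] alternating_sums[of "Suc k"] d
    by (simp only: Suc_lessD) algebra
  ultimately show ?thesis
    by (simp add: i divide_eq_minus_1_iff del: minus_diff_eq)
qed

text \<open>The sums of \<open>\<theta> i\<close> with its two neighbours take both values
  \<open>\<kappa>\<close> and \<open>- \<kappa>\<close>. A nonzero entry would make
  \<open>2 * \<theta> i\<close> one of them, so \<open>\<theta> i\<close> would coincide with a
  neighbouring eigenvalue.\<close>

lemma interior_diagonal_zero:
  assumes "0 < i" "i < d"
  shows "M i i = 0"
proof (rule ccontr)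
  assume "M i i \<noteq> 0"
  then have "\<theta> i + \<theta> i = \<kappa> \<or> \<theta> i + \<theta> i = - \<kappa>"
    using entry_nonzero_imp[of i i] assms by simp
  moreover obtain j where i: "i = Suc j"
    using assms(1) by (cases i) auto
  ultimately have "\<theta> i + \<theta> i = \<theta> j + \<theta> i \<or> \<theta> i + \<theta> i = \<theta> i + \<theta> (Suc i)"
    using consecutive_sum[of j] alternating_sums[of j] assms(2) by (metis Suc_lessD minus_minus)
  then have "\<theta> i = \<theta> j \<or> \<theta> i = \<theta> (Suc i)"
    by simp
  then show False
    using distinctD[of i j] distinctD[of i "Suc i"] assms i by auto
qed

text \<open>Starting from \<open>\<theta> 0 = \<plusminus>\<kappa>/2\<close> the alternation forces \<open>\<theta> i = \<plusminus>(2i + 1)\<kappa>/2\<close>, so the other end cannot be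
  \<open>\<plusminus>\<kappa>/2\<close> as well.\<close>

lemma one_end_zero:
  assumes "0 < d"
  shows "M 0 0 = 0 \<or> M d d = 0"
proof (rule ccontr)
  assume "\<not> ?thesis"
  then have ends: "(2 * \<theta> 0)\<^sup>2 = \<kappa>\<^sup>2" "(2 * \<theta> d)\<^sup>2 = \<kappa>\<^sup>2"
    using entry_nonzero_imp[of 0 0] entry_nonzero_imp[of d d]
    by (simp_all only: power2_eq_iff mult_2) simp_all
  have step: "\<theta> i + \<theta> (Suc i) = (-1) ^ Suc i * (2 * \<theta> 0)" if "i < d" for i
    using that
  proof (induction i)
    case 0
    have "2 * \<theta> 0 = \<kappa> \<or> 2 * \<theta> 0 = - \<kappa>"
      using ends(1) by (simp only: power2_eq_iff)
    moreover have "2 * \<theta> 0 \<noteq> \<theta> 0 + \<theta> (Suc 0)"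
      unfolding mult_2 using distinctD[of 0 "Suc 0"] 0 by auto
    ultimately have "\<theta> 0 + \<theta> (Suc 0) = - (2 * \<theta> 0)"
      using consecutive_sum[OF 0] by (intro signs_opposite)
    then show ?case
      by simp
  next
    case (Suc i)
    then show ?case
      by (simp only: alternating_sums Suc_lessD power_Suc) simp
  qed
  have "\<theta> i = (-1) ^ i * (2 * of_nat i + 1) * \<theta> 0" if "i \<le> d" for i
    using that
  proof (induction i)
    case (Suc i)
    then have "\<theta> (Suc i) = (-1) ^ Suc i * (2 * \<theta> 0) - \<theta> i"
      using step[of i] by (simp add: eq_diff_eq add.commute)
    then show ?case
      using Suc by (simp add: algebra_simps)
  qed simp
  from this[of d] have "(2 * \<theta> d)\<^sup>2 = (2 * of_nat d + 1)\<^sup>2 * (2 * \<theta> 0)\<^sup>2"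
    by (simp add: power_mult_distrib power_even_eq[symmetric])
  then have "(2 * of_nat d + 1)\<^sup>2 = (1 :: 'k)"
    unfolding ends using \<kappa>_nonzero by simp
  then have "(of_nat (2 * d + 1))\<^sup>2 = (1 :: 'k)"
    by (simp only: of_nat_add of_nat_mult of_nat_numeral of_nat_1)
  then have "(2 * d + 1)\<^sup>2 = (1 :: nat)"
    by (metis of_nat_power of_nat_1 of_nat_eq_iff)
  then show False
    using assms by (simp add: power2_eq_square)
qed

text \<open>The trace reduces to the two end entries, of which at most one is nonzero, so they
  cannot cancel. For \<open>d = 0\<close> the ends coincide and the trace is the single
  entry.\<close>

lemma trace_zero_imp_bipartite:
  assumes "(\<Sum>i\<le>d. M i i) = 0"
  shows "bipartite_matrix d M"
proof -
  have "M 0 0 = 0 \<and> M d d = 0"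
  proof (cases "d = 0")
    case False
    have "(\<Sum>i\<le>d. M i i) = (\<Sum>i\<in>{0, d}. M i i)"
      by (rule sum.mono_neutral_right) (auto intro!: interior_diagonal_zero)
    then show ?thesis
      using False assms one_end_zero by auto
  qed (use assms in simp)
  then show ?thesis
    by (auto simp: bipartite_matrix_def)
      (metis interior_diagonal_zero le_neq_implies_less not_gr_zero)
qed

lemma trace_nonzero_imp_almost_bipartite:
  assumes "(\<Sum>i\<le>d. M i i) \<noteq> 0"
  shows "almost_bipartite_matrix d M"
proof -
  have "(\<Sum>i\<le>d. M i i) = (\<Sum>i\<in>{0, d}. M i i)"
    by (rule sum.mono_neutral_right) (auto intro!: interior_diagonal_zero)
  then have "M 0 0 \<noteq> 0 \<or> M d d \<noteq> 0"
    using assms by (cases "d = 0") auto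
  then have "\<exists>!i. i \<in> {0, d} \<and> M i i \<noteq> 0"
    using one_end_zero by (cases "d = 0") auto
  then show ?thesis
    by (simp add: almost_bipartite_matrix_def interior_diagonal_zero)
qed

end

section \<open>Operators satisfying the relations\<close>

text \<open>Roots are divided out one at a time. If \<open>p\<close> is \<open>x - a\<close> times
  \<open>q\<close>, then \<open>w\<close>, the value of \<open>q(T)\<close> at \<open>v\<close>, is
  either an eigenvector for \<open>a\<close> or zero, and in the latter case \<open>q\<close>
  replaces \<open>p\<close>.\<close>

lemma (in vector_space) eigenvector_of_annihilator:
  fixes v :: 'b
  assumes root: "\<And>p :: 'a poly. degree p > 0 \<Longrightarrow> \<exists>a. poly p a = 0"
    and T: "Vector_Spaces.linear scale scale T" and "v \<noteq> 0"
    and "p \<noteq> 0" "degree p \<le> n" "(\<Sum>i\<le>n. scale (coeff p i) ((T ^^ i) v)) = 0"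
  shows "\<exists>\<theta> u. u \<noteq> 0 \<and> T u = scale \<theta> u"
  using assms(4-)
proof (induction n arbitrary: p)
  case 0
  then have "coeff p 0 \<noteq> 0"
    by (metis le_zero_eq leading_coeff_0_iff)
  then show ?case
    using 0 \<open>v \<noteq> 0\<close> by simp
next
  case (Suc n)
  show ?case
  proof (cases "degree p = 0")
    case True
    then have "(\<Sum>i\<le>Suc n. scale (coeff p i) ((T ^^ i) v)) = (\<Sum>i\<in>{0}. scale (coeff p i) ((T ^^ i) v))"
      by (intro sum.mono_neutral_right) (auto simp: coeff_eq_0)
    moreover have "coeff p 0 \<noteq> 0"
      using True Suc.prems(1) by (metis leading_coeff_0_iff)
    ultimately show ?thesis
      using Suc.prems(3) \<open>v \<noteq> 0\<close> by simp
  next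
    case False
    then obtain a where "poly p a = 0"
      using root by blast
    then obtain q where p: "p = [:- a, 1:] * q"
      by (auto simp: poly_eq_0_iff_dvd)
    have q: "q \<noteq> 0" "degree q \<le> n"
      using Suc.prems(1,2) by (auto simp: p degree_mult_eq simp del: mult_pCons_left)
    define w where "w = (\<Sum>i\<le>n. scale (coeff q i) ((T ^^ i) v))"
    have "(\<Sum>i\<le>Suc n. scale (coeff (pCons 0 q) i) ((T ^^ i) v)) = T w"
      by (subst sum.atMost_Suc_shift) (simp add: w_def linear_sumD[OF T] linear_scaleD[OF T])
    moreover have "(\<Sum>i\<le>Suc n. scale (coeff q i) ((T ^^ i) v)) = w"
      using q by (simp add: w_def coeff_eq_0)
    moreover have "coeff p i = coeff (pCons 0 q) i - a * coeff q i" for i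
      by (simp add: p)
    then have "(\<Sum>i\<le>Suc n. scale (coeff p i) ((T ^^ i) v)) =
        (\<Sum>i\<le>Suc n. scale (coeff (pCons 0 q) i) ((T ^^ i) v)) -
        scale a (\<Sum>i\<le>Suc n. scale (coeff q i) ((T ^^ i) v))"
      by (simp only: scale_left_diff_distrib sum_subtractf scale_sum_right scale_scale)
    ultimately have "T w = scale a w"
      using Suc.prems(3) by simp
    then show ?thesis
      using Suc.IH[OF q] by (cases "w = 0") (auto simp: w_def)
  qed
qed

locale spin_operators = vector_space scale
  for scale :: "'k::{alg_closed_field, field_char_0} \<Rightarrow> 'v::ab_group_add \<Rightarrow> 'v" +
  fixes X Y Z :: "'v \<Rightarrow> 'v"
  assumes linear_X: "Vector_Spaces.linear scale scale X"
    and linear_Y: "Vector_Spaces.linear scale scale Y"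
    and linear_Z: "Vector_Spaces.linear scale scale Z"
    and XY: "X (Y v) + Y (X v) = scale 2 (Z v)"
    and YZ: "Y (Z v) + Z (Y v) = scale 2 (X v)"
    and ZX: "Z (X v) + X (Z v) = scale 2 (Y v)"
    and fin_dim: "\<exists>B. finite B \<and> span B = UNIV"
    and nontrivial: "(UNIV :: 'v set) \<noteq> {0}"
    and irreducible: "subspace W \<Longrightarrow> (\<And>w. w \<in> W \<Longrightarrow> X w \<in> W \<and> Y w \<in> W \<and> Z w \<in> W) \<Longrightarrow>
      W = {0} \<or> W = UNIV"
begin

lemmas linear_simps =
  linear_addD[OF linear_X] linear_addD[OF linear_Y] linear_addD[OF linear_Z]
  linear_scaleD[OF linear_X] linear_scaleD[OF linear_Y] linear_scaleD[OF linear_Z]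
  linear_minusD[OF linear_X] linear_minusD[OF linear_Y] linear_minusD[OF linear_Z]
  linear_diffD[OF linear_X] linear_diffD[OF linear_Y] linear_diffD[OF linear_Z]
  linear_zeroD[OF linear_X] linear_zeroD[OF linear_Y] linear_zeroD[OF linear_Z]

text \<open>Whatever is proved for \<open>X\<close> thereby holds for \<open>Y\<close> and
  \<open>Z\<close> with the roles rotated.\<close>

lemma cyclic: "spin_operators scale Y Z X"
proof (intro spin_operators.intro spin_operators_axioms.intro)
  fix W assume "subspace W" and "\<And>w. w \<in> W \<Longrightarrow> Y w \<in> W \<and> Z w \<in> W \<and> X w \<in> W"
  then show "W = {0} \<or> W = UNIV"
    by (intro irreducible) blast+
qed (rule vector_space_axioms linear_X linear_Y linear_Z XY YZ ZX fin_dim nontrivial)+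

text \<open>This sign change exchanges \<open>Y + Z\<close> with \<open>Y - Z\<close> and turns the
  eigenvalue -1 of \<open>X\<close> into 1, which halves the later case distinction.\<close>

lemma flip: "spin_operators scale (\<lambda>v. - X v) Y (\<lambda>v. - Z v)"
proof (intro spin_operators.intro spin_operators_axioms.intro)
  fix W assume W: "subspace W" and inv: "\<And>w. w \<in> W \<Longrightarrow> - X w \<in> W \<and> Y w \<in> W \<and> - Z w \<in> W"
  have "X w \<in> W \<and> Y w \<in> W \<and> Z w \<in> W" if "w \<in> W" for w
    using inv[OF that] subspace_neg[OF W] by fastforce
  then show "W = {0} \<or> W = UNIV"
    using irreducible W by blast
next
  show "- X (Y v) + Y (- X v) = scale 2 (- Z v)" for v
    using arg_cong[OF XY[of v], of uminus] by (simp add: linear_simps)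
  show "Y (- Z v) + - Z (Y v) = scale 2 (- X v)" for v
    using arg_cong[OF YZ[of v], of uminus] by (simp add: linear_simps)
  show "- Z (- X v) + - X (- Z v) = scale 2 (Y v)" for v
    using ZX[of v] by (simp add: linear_simps)
qed (rule fin_dim nontrivial vector_space_axioms linear_Y linear_minus linear_X linear_Z)+

lemma exists_eigenvector:
  assumes T: "Vector_Spaces.linear scale scale T"
  shows "\<exists>\<theta> u. u \<noteq> 0 \<and> T u = scale \<theta> u"
proof -
  obtain B where B: "finite B" "span B = UNIV"
    using fin_dim by blast
  obtain v :: 'v where "v \<noteq> 0"
    using nontrivial by auto
  let ?n = "card B"
  \<comment> \<open>The \<open>card B + 1\<close> iterates of \<open>v\<close> cannot be independent
    in a space spanned by \<open>B\<close>; their relation supplies an annihilating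
    polynomial.\<close>
  have "\<exists>c. (\<Sum>i\<le>?n. scale (c i) ((T ^^ i) v)) = 0 \<and> (\<exists>i\<le>?n. c i \<noteq> 0)"
  proof (rule ccontr)
    assume "\<not> ?thesis"
    then have "inj_on (\<lambda>i. (T ^^ i) v) {..?n} \<and> independent ((\<lambda>i. (T ^^ i) v) ` {..?n})"
      by (intro independent_family) auto
    then have "card {..?n} \<le> ?n"
      using independent_span_bound[of B "(\<lambda>i. (T ^^ i) v) ` {..?n}"] B by (auto simp: card_image)
    then show False
      by simp
  qed
  then obtain c i where c: "(\<Sum>i\<le>?n. scale (c i) ((T ^^ i) v)) = 0" "i \<le> ?n" "c i \<noteq> 0"
    by blast
  define p where "p = (\<Sum>i\<le>?n. monom (c i) i)"
  have coeff: "coeff p k = (if k \<le> ?n then c k else 0)" for k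
    by (simp add: p_def coeff_sum)
  show ?thesis
  proof (rule eigenvector_of_annihilator[OF _ T \<open>v \<noteq> 0\<close>, where p = p and n = ?n])
    show "degree p > 0 \<Longrightarrow> \<exists>a. poly p a = 0" for p :: "'k poly"
      by (rule alg_closed_imp_poly_has_root)
    show "p \<noteq> 0"
      using c coeff[of i] by auto
    show "degree p \<le> ?n"
      by (rule degree_le) (simp add: coeff)
    show "(\<Sum>i\<le>?n. scale (coeff p i) ((T ^^ i) v)) = 0"
      using c(1) by (simp add: coeff cong: sum.cong_simp)
  qed
qed

section \<open>The operators \<open>R\<close> and \<open>L\<close> and the central element\<close>

definition "R v = Y v + Z v"
definition "L v = Y v - Z v"

definition "\<Omega> v = X (X v) + Y (Y v) + Z (Z v)"

text \<open>As rewrite rules, this and the next two identities sort products into the order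
  \<open>X\<close>, \<open>Z\<close>, \<open>Y\<close>.\<close>

lemma Y_X: "Y (X v) = scale 2 (Z v) - X (Y v)"
  by (simp flip: XY[of v])

lemma Z_X: "Z (X v) = scale 2 (Y v) - X (Z v)"
  by (simp flip: ZX[of v])

lemma Y_Z: "Y (Z v) = scale 2 (X v) - Z (Y v)"
  by (simp flip: YZ[of v])

lemma \<Omega>_X: "\<Omega> (X v) = X (\<Omega> v)"
  by (simp add: \<Omega>_def linear_simps Y_X Z_X)

text \<open>Schur's argument: \<open>\<Omega>\<close> commutes with \<open>X\<close>, and by
  rotation with \<open>Y\<close> and \<open>Z\<close>, so an eigenspace of it is an invariant
  subspace; being nonzero, it is everything.\<close>

lemma \<Omega>_scalar: "\<exists>\<omega>. \<forall>v. \<Omega> v = scale \<omega> v"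
proof -
  interpret y: spin_operators scale Y Z X
    by (rule cyclic)
  interpret z: spin_operators scale Z X Y
    by (rule y.cyclic)
  have eq: "y.\<Omega> = \<Omega>" "z.\<Omega> = \<Omega>"
    by (auto simp: \<Omega>_def y.\<Omega>_def z.\<Omega>_def add_ac)
  have lin: "Vector_Spaces.linear scale scale \<Omega>"
    by (rule linearI) (simp_all add: \<Omega>_def linear_simps scale_right_distrib)
  obtain \<omega> u where u: "u \<noteq> 0" "\<Omega> u = scale \<omega> u"
    using exists_eigenvector[OF lin] by blast
  let ?W = "{v. \<Omega> v = scale \<omega> v}"
  have "?W = {0} \<or> ?W = UNIV"
  proof (rule irreducible)
    show "subspace ?W"
      by (rule subspaceI)
        (simp_all add: linear_zeroD[OF lin] linear_addD[OF lin] linear_scaleD[OF lin]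
          scale_right_distrib mult.commute)
    show "X w \<in> ?W \<and> Y w \<in> ?W \<and> Z w \<in> ?W" if "w \<in> ?W" for w
      using that \<Omega>_X[of w] y.\<Omega>_X[of w] z.\<Omega>_X[of w] by (simp add: eq linear_simps)
  qed
  then show ?thesis
    using u by auto
qed

text \<open>The squares contribute \<open>\<Omega>\<close> minus the square of \<open>X\<close>, and
  the mixed terms \<open>YZ + ZY\<close> contribute \<open>2 X\<close>; for \<open>L\<close> the
  mixed terms change sign.\<close>

lemma R_R: "R (R v) = \<Omega> v - X (X v) + scale 2 (X v)"
  by (simp add: R_def \<Omega>_def linear_simps Y_Z)

lemma L_L: "L (L v) = \<Omega> v - X (X v) - scale 2 (X v)"
  by (simp add: L_def \<Omega>_def linear_simps Y_Z)

lemma X_R: "X (R v) = scale 2 (R v) - R (X v)"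
  by (simp add: R_def linear_simps Y_X Z_X scale_right_distrib)

lemma X_L: "X (L v) = - scale 2 (L v) - L (X v)"
  by (simp add: L_def linear_simps Y_X Z_X scale_right_diff_distrib)

end

section \<open>Alternating chains of eigenvectors\<close>

definition weight :: "'k::comm_ring_1 \<Rightarrow> nat \<Rightarrow> 'k" where
  "weight \<theta> i = (-1) ^ i * (\<theta> + 2 * of_nat i)"

context spin_operators
begin

definition step :: "nat \<Rightarrow> 'v \<Rightarrow> 'v" where
  "step i = (if even i then L else R)"

primrec chain :: "'v \<Rightarrow> nat \<Rightarrow> 'v" where
  "chain u 0 = u"
| "chain u (Suc i) = step i (chain u i)"

lemma linear_R: "Vector_Spaces.linear scale scale R"
  and linear_L: "Vector_Spaces.linear scale scale L"
  by (rule linearI; simp add: R_def L_def linear_simps scale_right_distrib scale_right_diff_distrib)+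

lemma linear_step: "Vector_Spaces.linear scale scale (step i)"
  by (simp add: step_def linear_R linear_L)

lemma Y_eq: "Y v = scale (1/2) (R v + L v)"
  and Z_eq: "Z v = scale (1/2) (R v - L v)"
proof -
  have "scale (1/2) (w + w) = w" for w
    unfolding scale_right_distrib scale_left_distrib[symmetric] by simp
  then show "Y v = scale (1/2) (R v + L v)" "Z v = scale (1/2) (R v - L v)"
    by (simp_all add: R_def L_def)
qed

text \<open>\<open>L\<close> reflects an eigenvalue \<open>\<theta>\<close> to
  \<open>-2 - \<theta>\<close> and \<open>R\<close> reflects it to \<open>2 - \<theta>\<close>;
  alternating them, with \<open>L\<close> first, produces \<open>weight\<close>.\<close>

lemma chain_weight:
  assumes "X u = scale \<theta> u"
  shows "X (chain u i) = scale (weight \<theta> i) (chain u i)"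
proof (induction i)
  case (Suc i)
  have "X (step i (chain u i)) =
      scale (if even i then -2 else 2) (step i (chain u i)) - step i (X (chain u i))"
    by (simp add: step_def X_R X_L)
  also have "\<dots> = scale ((if even i then -2 else 2) - weight \<theta> i) (step i (chain u i))"
    by (simp add: Suc linear_scaleD[OF linear_step] scale_left_diff_distrib)
  also have "(if even i then -2 else 2) - weight \<theta> i = weight \<theta> (Suc i)"
    by (simp add: weight_def algebra_simps)
  finally show ?case
    by simp
qed (simp add: assms weight_def)

text \<open>The same operator is applied twice here, and \<open>L\<close> squared and
  \<open>R\<close> squared are scalar on an eigenvector of \<open>X\<close>. Thus
  \<open>step i\<close> also leads back down the chain, with factor \<open>c i\<close>.\<close>

lemma step_chain_Suc:
  assumes "X u = scale \<theta> u"
  shows "\<exists>c. \<forall>i. step i (chain u (Suc i)) = scale (c i) (chain u i)"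
proof -
  obtain \<omega> where \<omega>: "\<And>v. \<Omega> v = scale \<omega> v"
    using \<Omega>_scalar by blast
  have "step i (chain u (Suc i)) = scale (\<omega> - (weight \<theta> i)\<^sup>2 + (if even i then -2 else 2) * weight \<theta> i) (chain u i)" for i
    by (simp add: step_def R_R L_L \<omega> chain_weight[OF assms] linear_simps scale_left_diff_distrib
        scale_left_distrib power2_eq_square)
  then show ?thesis
    by (intro exI[of _ "\<lambda>i. \<omega> - (weight \<theta> i)\<^sup>2 + (if even i then -2 else 2) * weight \<theta> i"] allI)
qed

lemma chain_nonzero_mono: "chain u j \<noteq> 0 \<Longrightarrow> i \<le> j \<Longrightarrow> chain u i \<noteq> 0"
proof (induction j)
  case (Suc j)
  then have "chain u j \<noteq> 0"
    using linear_zeroD[OF linear_step] by auto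
  then show ?case
    using Suc by (cases "i = Suc j") auto
qed simp

text \<open>A chain that never vanished would yield arbitrarily many independent eigenvectors.
  Distinctness is asked of nonzero chain vectors only, which is what \<open>weights_distinct\<close>
  provides.\<close>

lemma chain_ends:
  assumes "u \<noteq> 0" and X: "X u = scale \<theta> u"
    and distinct: "\<And>i j. chain u i \<noteq> 0 \<Longrightarrow> chain u j \<noteq> 0 \<Longrightarrow> weight \<theta> i = weight \<theta> j \<Longrightarrow> i = j"
  shows "\<exists>d. (\<forall>i\<le>d. chain u i \<noteq> 0) \<and> chain u (Suc d) = 0"
proof -
  have "\<exists>n. chain u n = 0"
  proof (rule ccontr)
    assume nonzero: "\<nexists>n. chain u n = 0"
    obtain B where B: "finite B" "span B = UNIV"
      using fin_dim by blast
    have "inj_on (chain u) {..card B} \<and> independent (chain u ` {..card B})"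
      using nonzero by (intro eigenvectors_independent[OF linear_X, where \<theta> = "weight \<theta>"])
        (auto intro!: inj_onI distinct simp: chain_weight[OF X])
    then have "card {..card B} \<le> card B"
      using independent_span_bound[of B "chain u ` {..card B}"] B by (auto simp: card_image)
    then show False
      by simp
  qed
  then obtain d where d: "(LEAST n. chain u n = 0) = Suc d"
    using \<open>u \<noteq> 0\<close> by (metis (mono_tags, lifting) LeastI_ex chain.simps(1) not0_implies_Suc)
  have "chain u (Suc d) = 0"
    using \<open>\<exists>n. chain u n = 0\<close> d by (metis (mono_tags, lifting) LeastI_ex)
  moreover have "chain u i \<noteq> 0" if "i \<le> d" for i
    using not_less_Least[of i "\<lambda>n. chain u n = 0"] that d by simp
  ultimately show ?thesis
    by blast
qed

text \<open>\<open>Z\<close> is left out because its matrix turns out to have the same zero pattern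
  as that of \<open>Y\<close>.\<close>

definition diag_tridiag_basis :: "nat \<Rightarrow> (nat \<Rightarrow> 'v) \<Rightarrow> bool" where
  "diag_tridiag_basis d v \<longleftrightarrow> ordered_basis scale d v \<and>
     (\<exists>\<theta>. \<forall>i\<le>d. X (v i) = scale (\<theta> i) (v i)) \<and>
     irreducible_tridiagonal d (matrix_wrt scale d v Y)"

text \<open>Going up, the tail ends in zero after \<open>d\<close>. Going down, it cannot be left at
  \<open>k\<close>: either \<open>R u\<close> is a multiple of \<open>u\<close>, or the factor
  \<open>c j\<close> vanishes.\<close>

lemma chain_tail_invariant:
  assumes X: "X u = scale \<theta> u" and R: "R u = scale \<rho> u"
    and c: "\<And>i. step i (chain u (Suc i)) = scale (c i) (chain u i)"
    and k: "k = 0 \<or> k = Suc j \<and> c j = 0" and d: "chain u (Suc d) = 0"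
    and w: "w \<in> span (chain u ` {k..d})"
  shows "X w \<in> span (chain u ` {k..d}) \<and> R w \<in> span (chain u ` {k..d}) \<and> L w \<in> span (chain u ` {k..d})"
proof -
  let ?W = "span (chain u ` {k..d})"
  have span_closed: "T w \<in> ?W"
    if T: "Vector_Spaces.linear scale scale T" and "\<And>i. k \<le> i \<Longrightarrow> i \<le> d \<Longrightarrow> T (chain u i) \<in> ?W" for T
    using w
    by (induction rule: span_induct_alt)
      (auto simp: linear_zeroD[OF T] linear_addD[OF T] linear_scaleD[OF T]
        intro!: span_zero span_add span_scale that(2))
  have up: "step i (chain u i) \<in> ?W" if "k \<le> i" "i \<le> d" for i
  proof (cases "i = d")
    case False
    then show ?thesis
      using that by (intro span_base) (auto intro!: image_eqI[of _ _ "Suc i"])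
  qed (use d in \<open>simp add: span_zero\<close>)
  have down: "step (Suc i) (chain u i) \<in> ?W" if i: "k \<le> i" "i \<le> d" for i
  proof (cases i)
    case 0
    then show ?thesis
      using i R by (auto simp: step_def intro!: span_scale[OF span_base] image_eqI[of _ _ 0])
  next
    case (Suc l)
    \<comment> \<open>Since \<open>i = Suc l\<close>, the indices \<open>Suc i\<close> and
      \<open>l\<close> have the same parity and so name the same operator.\<close>
    have "step (Suc i) (chain u i) = scale (c l) (chain u l)"
      using c[of l] by (simp add: Suc step_def)
    moreover have "c l = 0 \<or> k \<le> l"
      using k i Suc by (cases "l = j") auto
    moreover have "chain u l \<in> ?W" if "k \<le> l"
      using that i Suc by (intro span_base imageI) simp
    ultimately show ?thesis
      by (auto simp: span_zero intro: span_scale)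
  qed
  have "R (chain u i) \<in> ?W" "L (chain u i) \<in> ?W" if "k \<le> i" "i \<le> d" for i
    using up[OF that] down[OF that] by (auto simp: step_def split: if_splits)
  moreover have "X (chain u i) \<in> ?W" if "k \<le> i" "i \<le> d" for i
    using that by (auto simp: chain_weight[OF X] intro!: span_scale[OF span_base])
  ultimately show ?thesis
    using span_closed[OF linear_X] span_closed[OF linear_R] span_closed[OF linear_L] by blast
qed

lemma chain_tail_trivial:
  assumes "X u = scale \<theta> u" and "R u = scale \<rho> u"
    and "\<And>i. step i (chain u (Suc i)) = scale (c i) (chain u i)"
    and "k = 0 \<or> k = Suc j \<and> c j = 0" and "chain u (Suc d) = 0"
  shows "span (chain u ` {k..d}) = {0} \<or> span (chain u ` {k..d}) = UNIV"
proof (rule irreducible)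
  fix w assume "w \<in> span (chain u ` {k..d})"
  from chain_tail_invariant[OF assms this]
  show "X w \<in> span (chain u ` {k..d}) \<and> Y w \<in> span (chain u ` {k..d}) \<and> Z w \<in> span (chain u ` {k..d})"
    by (simp add: Y_eq Z_eq span_scale span_add span_diff)
qed simp

text \<open>Irreducibility is used twice: the full chain spans because its span is invariant and
  nonzero, and \<open>c j = 0\<close> would make the tail after \<open>j\<close> span a proper
  nonzero invariant subspace. Hence the superdiagonal of \<open>Y\<close> has no zero.\<close>

lemma chain_basis:
  assumes "u \<noteq> 0" and X: "X u = scale \<theta> u" and R: "R u = scale \<rho> u"
    and distinct: "\<And>i j. chain u i \<noteq> 0 \<Longrightarrow> chain u j \<noteq> 0 \<Longrightarrow> weight \<theta> i = weight \<theta> j \<Longrightarrow> i = j"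
  shows "\<exists>d v. diag_tridiag_basis d v"
proof -
  obtain d where d: "\<And>i. i \<le> d \<Longrightarrow> chain u i \<noteq> 0" "chain u (Suc d) = 0"
    using chain_ends[OF \<open>u \<noteq> 0\<close> X distinct] by blast
  obtain c where c: "\<And>i. step i (chain u (Suc i)) = scale (c i) (chain u i)"
    using step_chain_Suc[OF X] by blast
  have indep: "inj_on (chain u) {..d} \<and> independent (chain u ` {..d})"
    using d(1) by (intro eigenvectors_independent[OF linear_X, where \<theta> = "weight \<theta>"])
      (auto intro!: inj_onI distinct simp: chain_weight[OF X])
  have "span (chain u ` {0..d}) \<noteq> {0}"
    using \<open>u \<noteq> 0\<close> span_base[of u "chain u ` {0..d}"] by (force intro: image_eqI[of _ _ 0])
  then have "span (chain u ` {0..d}) = UNIV"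
    using chain_tail_trivial[OF X R c _ d(2), of 0] by simp
  then have basis: "ordered_basis scale d (chain u)"
    using indep by (simp add: ordered_basis_def atLeast0AtMost)
  have c_nonzero: "c j \<noteq> 0" if "j < d" for j
  proof
    assume "c j = 0"
    then have "span (chain u ` {Suc j..d}) = {0} \<or> span (chain u ` {Suc j..d}) = UNIV"
      using chain_tail_trivial[OF X R c _ d(2), of "Suc j" j] by simp
    moreover have "chain u (Suc j) \<in> span (chain u ` {Suc j..d})"
      using that by (intro span_base imageI) simp
    then have "span (chain u ` {Suc j..d}) \<noteq> {0}"
      using d(1)[of "Suc j"] that by auto
    moreover have "u \<notin> span (chain u ` {Suc j..d})"
    proof -
      have "u \<noteq> chain u i" if "Suc j \<le> i" "i \<le> d" for i
        using inj_onD[OF indep[THEN conjunct1], of i 0] that by auto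
      then have "chain u ` {Suc j..d} \<subseteq> chain u ` {..d} - {chain u 0}"
        by fastforce
      then show ?thesis
        using indep span_mono unfolding dependent_def by (metis atMost_iff chain.simps(1) imageI in_mono zero_le)
    qed
    ultimately show False
      by auto
  qed
  \<comment> \<open>The halves come from \<open>Y = (R + L)/2\<close>. The corner entry records
    \<open>R u = \<rho> u\<close> at the start, where there is no predecessor.\<close>
  define m where "m i j = (if i = Suc j then 1/2 else if j = Suc i then c i / 2
    else if i = 0 \<and> j = 0 then \<rho> / 2 else 0)" for i j
  have matrix: "matrix_wrt scale d (chain u) Y i j = m i j" if i: "i \<le> d" and j: "j \<le> d" for i j
  proof -
    have RL: "Y (chain u j) = scale (1/2) (chain u (Suc j) + step (Suc j) (chain u j))"
      by (simp add: Y_eq step_def add.commute)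
    \<comment> \<open>For \<open>j = d\<close> the vector is zero, and \<open>i = Suc j\<close> is
      impossible.\<close>
    have Suc_j: "coord scale d (chain u) (chain u (Suc j)) i = (if i = Suc j then 1 else 0)"
      using i j d(2) by (cases "j = d")
        (auto simp: coord_basis[OF basis] coord_zero[OF basis] simp del: chain.simps)
    show ?thesis
    proof (cases j)
      case 0
      then show ?thesis
        using R Suc_j i unfolding matrix_wrt_eq_coord RL
        by (auto simp: m_def step_def coord_add[OF basis] coord_scale[OF basis]
            coord_basis[OF basis, of _ 0, simplified] simp del: chain.simps(2))
    next
      case (Suc l)
      have "step (Suc j) (chain u j) = scale (c l) (chain u l)"
        using c[of l] by (simp add: Suc step_def)
      then show ?thesis
        using Suc_j i j Suc unfolding matrix_wrt_eq_coord RL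
        by (auto simp: m_def coord_add[OF basis] coord_scale[OF basis] coord_basis[OF basis]
            simp del: chain.simps)
    qed
  qed
  have "irreducible_tridiagonal d (matrix_wrt scale d (chain u) Y)"
    using c_nonzero by (auto simp: irreducible_tridiagonal_def matrix m_def)
  then show ?thesis
    using basis chain_weight[OF X] unfolding diag_tridiag_basis_def by blast
qed

end

section \<open>Coinciding weights and the choice of a starting vector\<close>

lemma weight_eqD:
  fixes \<theta> :: "'k::field_char_0"
  assumes "weight \<theta> i = weight \<theta> j"
  shows "i = j \<or> odd (i + j) \<and> \<theta> = - of_nat (i + j)"
proof (cases "even i = even j")
  case True
  then have "\<theta> + 2 * of_nat i = \<theta> + 2 * of_nat j"
    using assms by (simp add: weight_def minus_one_power_iff split: if_splits)
  then show ?thesis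
    by simp
next
  case False
  then have "\<theta> + 2 * of_nat i = - (\<theta> + 2 * of_nat j) \<or> - (\<theta> + 2 * of_nat i) = \<theta> + 2 * of_nat j"
    using assms
    by (cases "even i") (auto simp: weight_def minus_one_power_iff simp del: minus_add_distrib)
  then have "\<theta> + 2 * of_nat i = - (\<theta> + 2 * of_nat j)"
    by (metis minus_minus)
  then have "2 * (\<theta> + of_nat (i + j)) = 0"
    by (simp add: algebra_simps eq_neg_iff_add_eq_0)
  then have "\<theta> + of_nat (i + j) = 0"
    by (simp only: mult_eq_0_iff) simp
  then have "\<theta> = - of_nat (i + j)"
    by (simp only: eq_neg_iff_add_eq_0)
  then show ?thesis
    using False by simp
qed

context spin_operators
begin

text \<open>The reflection \<open>2 - \<theta>\<close> fixes 1, so \<open>R\<close> preserves this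
  eigenspace and its square is \<open>\<omega> + 1\<close> there. Hence \<open>R\<close> has an
  eigenvector in it, from which a chain can start.\<close>

lemma basis_if_weight_one:
  assumes "u \<noteq> 0" and X: "X u = u"
  shows "\<exists>d v. diag_tridiag_basis d v"
proof -
  obtain \<omega> where \<omega>: "\<And>v. \<Omega> v = scale \<omega> v"
    using \<Omega>_scalar by blast
  obtain \<rho> where \<rho>: "\<rho> ^ 2 = \<omega> + 1"
    using nth_root_exists[of 2 "\<omega> + 1"] by auto
  have XR: "X (R u) = R u"
    unfolding X_R X by (simp add: scale_left_distrib[of 1 1, simplified])
  have "R (R u) = scale (\<omega> + 1) u"
    unfolding R_R X \<omega> by (simp add: scale_left_distrib scale_left_distrib[of 1 1, simplified])
  then have RR: "R (R u) = scale \<rho> (scale \<rho> u)"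
    by (simp add: \<rho>[symmetric] power2_eq_square)
  \<comment> \<open>Since \<open>(R - \<rho>)(R + \<rho>)\<close> kills \<open>u\<close>, either
    \<open>u\<close> itself or its image under \<open>R + \<rho>\<close> is an eigenvector of
    \<open>R\<close>.\<close>
  obtain w \<sigma> where w: "w \<noteq> 0" "X w = scale 1 w" "R w = scale \<sigma> w"
  proof (cases "R u + scale \<rho> u = 0")
    case True
    then have "R u = scale (- \<rho>) u"
      by (simp add: eq_neg_iff_add_eq_0)
    then show thesis
      using assms that[of u "- \<rho>"] by simp
  next
    case False
    then show thesis
      using that[of "R u + scale \<rho> u" \<rho>]
      by (simp add: linear_simps linear_addD[OF linear_R] linear_scaleD[OF linear_R] X XR RR
          scale_right_distrib add.commute)
  qed
  have "i = j" if eq: "weight (1 :: 'k) i = weight 1 j" for i j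
  proof -
    have "(1 :: 'k) \<noteq> - of_nat (i + j)"
    proof
      assume "(1 :: 'k) = - of_nat (i + j)"
      then have "of_nat (Suc (i + j)) = (0 :: 'k)"
        by (simp only: of_nat_Suc eq_neg_iff_add_eq_0)
      then show False
        by (simp only: of_nat_eq_0_iff)
    qed
    then show ?thesis
      using weight_eqD[OF eq] by blast
  qed
  then show ?thesis
    using chain_basis[OF w] by blast
qed

text \<open>A coincidence forces \<open>i + j = 2 * m + 1\<close> and
  \<open>\<theta> = - (2 * m + 1)\<close>. The chain vector at the midpoint \<open>m\<close> is then
  nonzero with weight 1 or -1, which is excluded.\<close>

lemma weights_distinct:
  assumes X: "X u = scale \<theta> u" and no_unit: "\<And>w. w \<noteq> 0 \<Longrightarrow> X w \<noteq> w \<and> X w \<noteq> - w"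
    and nonzero: "chain u i \<noteq> 0" "chain u j \<noteq> 0" and eq: "weight \<theta> i = weight \<theta> j"
  shows "i = j"
proof (rule ccontr)
  assume "i \<noteq> j"
  then have "odd (i + j)" and \<theta>: "\<theta> = - of_nat (i + j)"
    using weight_eqD[OF eq] by auto
  from \<open>odd (i + j)\<close> obtain m where m: "i + j = 2 * m + 1"
    by (rule oddE)
  then have "m \<le> i \<or> m \<le> j"
    by linarith
  then have "chain u m \<noteq> 0"
    using nonzero chain_nonzero_mono by blast
  moreover have "weight \<theta> m = - ((-1) ^ m)"
    by (simp add: weight_def \<theta> m)
  then have "X (chain u m) = chain u m \<or> X (chain u m) = - chain u m"
    by (cases "even m") (simp_all add: chain_weight[OF X])
  ultimately show False
    using no_unit by blast
qed

lemma basis_if_killed_by_R: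
  assumes "u \<noteq> 0" "X u = scale \<theta> u" "R u = 0" "\<And>w. w \<noteq> 0 \<Longrightarrow> X w \<noteq> w \<and> X w \<noteq> - w"
  shows "\<exists>d v. diag_tridiag_basis d v"
  using assms weights_distinct[OF assms(2,4)] by (intro chain_basis[of u \<theta> 0]) auto

lemma diag_tridiag_basis_exists: "\<exists>d v. diag_tridiag_basis d v"
proof -
  interpret flipped: spin_operators scale "\<lambda>v. - X v" Y "\<lambda>v. - Z v"
    by (rule flip)
  have flipped_R: "flipped.R = L"
    by (auto simp: flipped.R_def L_def)
  \<comment> \<open>The vectors and \<open>Y\<close> are unchanged; only the eigenvalues of
    \<open>X\<close> are negated.\<close>
  have flipped_basis: "\<exists>d v. diag_tridiag_basis d v" if f: "\<exists>d v. flipped.diag_tridiag_basis d v"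
  proof -
    obtain d v \<theta> where "ordered_basis scale d v" "irreducible_tridiagonal d (matrix_wrt scale d v Y)"
        "\<forall>i\<le>d. - X (v i) = scale (\<theta> i) (v i)"
      using f unfolding flipped.diag_tridiag_basis_def by blast
    then have "diag_tridiag_basis d v"
      unfolding diag_tridiag_basis_def
      by (auto intro!: exI[of _ "\<lambda>i. - \<theta> i"]) (metis minus_minus)
    then show ?thesis
      by blast
  qed
  consider u where "u \<noteq> 0" "X u = u" | u where "u \<noteq> 0" "X u = - u"
    | (generic) "\<And>w. w \<noteq> 0 \<Longrightarrow> X w \<noteq> w \<and> X w \<noteq> - w"
    by blast
  then show ?thesis
  proof cases
    case 1
    then show ?thesis
      by (rule basis_if_weight_one)
  next
    case 2
    then show ?thesis
      by (intro flipped_basis flipped.basis_if_weight_one[of u]) auto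
  next
    case generic
    obtain \<theta> u where u: "u \<noteq> 0" "X u = scale \<theta> u"
      using exists_eigenvector[OF linear_X] by blast
    \<comment> \<open>An arbitrary eigenvector need not satisfy the condition on \<open>R\<close>,
      but its chain ends in a vector killed by \<open>L\<close> or \<open>R\<close>. A new chain is
      started there, after a flip in the case of \<open>L\<close>.\<close>
    have "\<exists>d. (\<forall>i\<le>d. chain u i \<noteq> 0) \<and> chain u (Suc d) = 0"
      by (rule chain_ends[OF u], rule weights_distinct[OF u(2) generic])
    then obtain d where d: "\<And>i. i \<le> d \<Longrightarrow> chain u i \<noteq> 0" "step d (chain u d) = 0"
      unfolding chain.simps by blast
    have end_vector: "chain u d \<noteq> 0" "X (chain u d) = scale (weight \<theta> d) (chain u d)"
      using d(1) chain_weight[OF u(2)] by auto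
    show ?thesis
    proof (cases "even d")
      case True
      have "\<exists>d v. flipped.diag_tridiag_basis d v"
      proof (rule flipped.basis_if_killed_by_R)
        show "- X (chain u d) = scale (- weight \<theta> d) (chain u d)"
          by (simp add: end_vector)
        show "flipped.R (chain u d) = 0"
          using d(2) True by (simp add: flipped_R step_def)
        show "- X w \<noteq> w \<and> - X w \<noteq> - w" if "w \<noteq> 0" for w
          using generic[OF that] by (auto simp: minus_equation_iff)
      qed (rule end_vector)
      then show ?thesis
        by (rule flipped_basis)
    next
      case False
      then show ?thesis
        using d(2) by (intro basis_if_killed_by_R[OF end_vector] generic) (simp add: step_def)
    qed
  qed
qed

text \<open>Entrywise, two of the relations say that \<open>\<theta> i + \<theta> j\<close> times an
  entry of \<open>Y\<close> is twice that of \<open>Z\<close>, and conversely. So the two matrices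
  vanish at the same places.\<close>

lemma leonard_triple_basis_exists: "\<exists>d v. leonard_triple_basis scale d v X Y Z"
proof -
  obtain d v \<theta> where basis: "ordered_basis scale d v"
      and tri: "irreducible_tridiagonal d (matrix_wrt scale d v Y)"
      and eig: "\<And>i. i \<le> d \<Longrightarrow> X (v i) = scale (\<theta> i) (v i)"
    using diag_tridiag_basis_exists unfolding diag_tridiag_basis_def by blast
  have entry: "(\<theta> i + \<theta> j) * coord scale d v (S (v j)) i = 2 * coord scale d v (T (v j)) i"
    if "i \<le> d" "j \<le> d" "\<And>v. X (S v) + S (X v) = scale 2 (T v)"
      and S: "Vector_Spaces.linear scale scale S" for i j S T
  proof -
    have "coord scale d v (X (S (v j)) + S (X (v j))) i = coord scale d v (scale 2 (T (v j))) i"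
      by (simp only: that(3))
    then show ?thesis
      using that(1,2)
      by (simp add: coord_add[OF basis] coord_scale[OF basis] coord_diagonal[OF basis linear_X eig]
          eig linear_scaleD[OF S] distrib_right)
  qed
  have "matrix_wrt scale d v Y i j = 0 \<longleftrightarrow> matrix_wrt scale d v Z i j = 0" if "i \<le> d" "j \<le> d" for i j
    using entry[OF that XY linear_Y] entry[OF that ZX[unfolded add.commute[of "Z _"]] linear_Z]
    by (auto simp: matrix_wrt_eq_coord)
  then have "irreducible_tridiagonal d (matrix_wrt scale d v Z)"
    using tri by (simp add: irreducible_tridiagonal_def)
  then show ?thesis
    using basis tri diagonal_matrixI[OF basis eig] unfolding leonard_triple_basis_def by blast
qed

text \<open>Each identity eliminates the third operator from the two relations that involve
  \<open>X\<close>.\<close>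

lemma cubic_XY: "X (X (Y v)) + scale 2 (X (Y (X v))) + Y (X (X v)) = scale 4 (Y v)"
  and cubic_XZ: "X (X (Z v)) + scale 2 (X (Z (X v))) + Z (X (X v)) = scale 4 (Z v)"
proof -
  have "scale 2 w = w + w" "scale 4 w = w + w + w + w" for w
    by (simp_all flip: scale_left_distrib[of 1 1, simplified] scale_left_distrib[of 2 1, simplified]
        scale_left_distrib[of 3 1, simplified])
  then show "X (X (Y v)) + scale 2 (X (Y (X v))) + Y (X (X v)) = scale 4 (Y v)"
    and "X (X (Z v)) + scale 2 (X (Z (X v))) + Z (X (X v)) = scale 4 (Z v)"
    by (simp_all add: Y_X Z_X linear_simps)
qed

end

section \<open>Leonard triples from modules\<close>

context vector_space
begin

lemma matrix_wrt_scaled: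
  assumes "ordered_basis scale d v"
  shows "matrix_wrt scale d v (\<lambda>x. scale c (T x)) i j = c * matrix_wrt scale d v T i j"
  by (simp add: matrix_wrt_eq_coord coord_scale[OF assms])

lemma leonard_triple_basis_scaled:
  assumes "leonard_triple_basis scale d v A B C" and "a \<noteq> 0" "b \<noteq> 0" "c \<noteq> 0"
  shows "leonard_triple_basis scale d v (\<lambda>x. scale a (A x)) (\<lambda>x. scale b (B x)) (\<lambda>x. scale c (C x))"
  using assms
  by (auto simp: leonard_triple_basis_def matrix_wrt_scaled diagonal_matrix_def irreducible_tridiagonal_def)

lemma leonard_triple_imp_pairs:
  assumes "leonard_triple scale A B C"
  shows "leonard_pair scale A B" "leonard_pair scale B A" "leonard_pair scale B C"
    "leonard_pair scale C B" "leonard_pair scale C A" "leonard_pair scale A C"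
  using assms unfolding leonard_triple_def leonard_pair_def leonard_triple_basis_def leonard_basis_def
  by blast+

end

text \<open>For \<open>A = \<xi>x\<close> and \<open>B = \<xi>\<^sup>*y\<close> one has \<open>\<kappa> = 2\<xi>\<close>.\<close>

definition cubic_relation ::
  "('k::field \<Rightarrow> 'v::ab_group_add \<Rightarrow> 'v) \<Rightarrow> ('v \<Rightarrow> 'v) \<Rightarrow> ('v \<Rightarrow> 'v) \<Rightarrow> bool" where
  "cubic_relation scale A B \<longleftrightarrow>
     (\<exists>\<kappa>. \<kappa> \<noteq> 0 \<and> (\<forall>x. A (A (B x)) + scale 2 (A (B (A x))) + B (A (A x)) = scale (\<kappa>\<^sup>2) (B x)))"

locale cubic_leonard_pair = vector_space scale
  for scale :: "'k::field_char_0 \<Rightarrow> 'v::ab_group_add \<Rightarrow> 'v" +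
  fixes A B :: "'v \<Rightarrow> 'v"
  assumes pair: "leonard_pair scale A B" and cubic: "cubic_relation scale A B"
begin

text \<open>The definitions speak of every choice of bases, so \<open>v\<close> is arbitrary here.
  Distinctness of its eigenvalues comes from the other basis of the pair, in which \<open>A\<close>
  is irreducible tridiagonal.\<close>

lemma bannai_ito_basisI:
  assumes v: "ordered_basis scale d v" "irreducible_tridiagonal d (matrix_wrt scale d v B)"
    and eig: "\<And>i. i \<le> d \<Longrightarrow> A (v i) = scale (\<theta> i) (v i)"
  shows "\<exists>\<kappa>. bannai_ito_basis scale A B d v \<theta> \<kappa>"
proof -
  obtain e w where w: "leonard_basis scale e w B A"
    using pair by (auto simp: leonard_pair_def)
  have lin: "Vector_Spaces.linear scale scale A" "Vector_Spaces.linear scale scale B"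
    using pair by (simp_all add: leonard_pair_def)
  have "inj_on \<theta> {..d}"
    using w eig by (intro tridiagonal_eigenvalues_distinct[OF v(1) _ lin(1), of e w])
      (simp_all add: leonard_basis_def)
  moreover obtain \<kappa> where "\<kappa> \<noteq> 0"
      "\<And>x. A (A (B x)) + scale 2 (A (B (A x))) + B (A (A x)) = scale (\<kappa>\<^sup>2) (B x)"
    using cubic by (auto simp: cubic_relation_def)
  ultimately have "bannai_ito_basis scale A B d v \<theta> \<kappa>"
    by (intro bannai_ito_basis.intro bannai_ito_basis_axioms.intro vector_space_axioms lin v eig)
  then show ?thesis
    by blast
qed

lemma tridiagonal_shape:
  assumes v: "ordered_basis scale d v" "irreducible_tridiagonal d (matrix_wrt scale d v B)"
    and diag: "diagonal_matrix d (matrix_wrt scale d v A)" and u: "ordered_basis scale e u"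
  shows "(\<Sum>i\<le>e. matrix_wrt scale e u B i i) = 0 \<Longrightarrow> bipartite_matrix d (matrix_wrt scale d v B)"
    and "(\<Sum>i\<le>e. matrix_wrt scale e u B i i) \<noteq> 0 \<Longrightarrow> almost_bipartite_matrix d (matrix_wrt scale d v B)"
proof -
  obtain \<kappa> where "bannai_ito_basis scale A B d v (\<lambda>i. matrix_wrt scale d v A i i) \<kappa>"
    using bannai_ito_basisI[OF v diagonal_eigenvector[OF v(1) diag]] by blast
  then interpret bannai_ito_basis scale A B d v "\<lambda>i. matrix_wrt scale d v A i i" \<kappa> .
  have "(\<Sum>i\<le>e. matrix_wrt scale e u B i i) = (\<Sum>i\<le>d. M i i)"
    by (rule trace_independent[OF u v(1) linear_B])
  then show "(\<Sum>i\<le>e. matrix_wrt scale e u B i i) = 0 \<Longrightarrow> bipartite_matrix d M"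
    and "(\<Sum>i\<le>e. matrix_wrt scale e u B i i) \<noteq> 0 \<Longrightarrow> almost_bipartite_matrix d M"
    using trace_zero_imp_bipartite trace_nonzero_imp_almost_bipartite by auto
qed

end

lemma bannai_ito_pairI:
  assumes AB: "cubic_leonard_pair scale A B" and BA: "cubic_leonard_pair scale B A"
  shows "bannai_ito_pair scale A B"
  unfolding bannai_ito_pair_def
proof (intro conjI allI impI; (elim conjE)?)
  show "leonard_pair scale A B"
    using AB by (rule cubic_leonard_pair.pair)
  fix d v w \<theta> \<theta>s i
  assume v: "leonard_basis scale d v A B" and w: "leonard_basis scale d w B A"
    and \<theta>: "\<forall>i\<le>d. A (v i) = scale (\<theta> i) (v i)" and \<theta>s: "\<forall>i\<le>d. B (w i) = scale (\<theta>s i) (w i)"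
    and i: "2 \<le> i" "i \<le> d - 1"
  have "\<exists>\<kappa>. bannai_ito_basis scale A B d v \<theta> \<kappa>" "\<exists>\<kappa>. bannai_ito_basis scale B A d w \<theta>s \<kappa>"
    using v w \<theta> \<theta>s cubic_leonard_pair.bannai_ito_basisI[OF AB, of d v \<theta>]
      cubic_leonard_pair.bannai_ito_basisI[OF BA, of d w \<theta>s]
    by (simp_all add: leonard_basis_def)
  then show "(\<theta> (i - 2) - \<theta> (i + 1)) / (\<theta> (i - 1) - \<theta> i) = -1"
    and "(\<theta>s (i - 2) - \<theta>s (i + 1)) / (\<theta>s (i - 1) - \<theta>s i) = -1"
    using bannai_ito_basis.bannai_ito_ratio i by blast+
qed

lemma all_tridiagonalsI:
  assumes "cubic_leonard_pair scale A B" "cubic_leonard_pair scale B A"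
    and "cubic_leonard_pair scale B C" "cubic_leonard_pair scale C B"
    and "cubic_leonard_pair scale C A" "cubic_leonard_pair scale A C"
    and u: "ordered_basis scale e u"
  shows "\<lbrakk>\<And>T. T \<in> {A, B, C} \<Longrightarrow> (\<Sum>i\<le>e. matrix_wrt scale e u T i i) = 0\<rbrakk> \<Longrightarrow>
      all_tridiagonals scale bipartite_matrix A B C"
    and "\<lbrakk>\<And>T. T \<in> {A, B, C} \<Longrightarrow> (\<Sum>i\<le>e. matrix_wrt scale e u T i i) \<noteq> 0\<rbrakk> \<Longrightarrow>
      all_tridiagonals scale almost_bipartite_matrix A B C"
  unfolding all_tridiagonals_def leonard_triple_basis_def
  using assms(1-6)[THEN cubic_leonard_pair.tridiagonal_shape(1)]
    assms(1-6)[THEN cubic_leonard_pair.tridiagonal_shape(2)] u by auto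

context spin_operators
begin

lemma scaled_leonard_triple:
  assumes "a \<noteq> 0" "b \<noteq> 0" "c \<noteq> 0"
  shows "leonard_triple scale (\<lambda>v. scale a (X v)) (\<lambda>v. scale b (Y v)) (\<lambda>v. scale c (Z v))"
proof -
  interpret y: spin_operators scale Y Z X
    by (rule cyclic)
  interpret z: spin_operators scale Z X Y
    by (rule y.cyclic)
  obtain d1 d2 d3 u v w where bases: "leonard_triple_basis scale d1 u X Y Z"
      "leonard_triple_basis scale d2 v Y Z X" "leonard_triple_basis scale d3 w Z X Y"
    using leonard_triple_basis_exists y.leonard_triple_basis_exists z.leonard_triple_basis_exists
    by blast
  moreover have "d2 = d1" "d3 = d1"
    using bases ordered_basis_same_length unfolding leonard_triple_basis_def by blast+
  moreover have "Vector_Spaces.linear scale scale (\<lambda>v. scale k (T v))"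
    if "Vector_Spaces.linear scale scale T" for k T
    using that
    by (intro linearI) (simp_all add: linear_addD linear_scaleD scale_right_distrib mult.commute)
  ultimately show ?thesis
    using assms leonard_triple_basis_scaled linear_X linear_Y linear_Z
    unfolding leonard_triple_def by blast
qed

lemma scaled_cubic_relations:
  assumes "a \<noteq> 0"
  shows "cubic_relation scale (\<lambda>v. scale a (X v)) (\<lambda>v. scale b (Y v))"
    and "cubic_relation scale (\<lambda>v. scale a (X v)) (\<lambda>v. scale b (Z v))"
proof -
  \<comment> \<open>Every term of the relation has degree two in \<open>A\<close> and one in
    \<open>B\<close>, so rescaling multiplies it by \<open>a * a * b\<close>.\<close>
  have scaled: "scale (a * a * b) p + scale 2 (scale (a * a * b) q) + scale (a * a * b) r =
      scale ((2 * a)\<^sup>2) (scale b s)" if "p + scale 2 q + r = scale 4 s" for p q r s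
  proof -
    have "scale (a * a * b) (p + scale 2 q + r) = scale (a * a * b) (scale 4 s)"
      by (simp only: that)
    then show ?thesis
      by (simp add: scale_right_distrib power2_eq_square mult_ac)
  qed
  have "2 * a \<noteq> 0"
    using assms by simp
  then show "cubic_relation scale (\<lambda>v. scale a (X v)) (\<lambda>v. scale b (Y v))"
    and "cubic_relation scale (\<lambda>v. scale a (X v)) (\<lambda>v. scale b (Z v))"
    unfolding cubic_relation_def using scaled[OF cubic_XY] scaled[OF cubic_XZ]
    by (auto intro!: exI[of _ "2 * a"] simp: linear_simps mult_ac)
qed

lemma scaled_cubic_pairs:
  assumes "a \<noteq> 0" "b \<noteq> 0" "c \<noteq> 0"
  defines "A \<equiv> \<lambda>v. scale a (X v)" and "B \<equiv> \<lambda>v. scale b (Y v)" and "C \<equiv> \<lambda>v. scale c (Z v)"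
  shows "cubic_leonard_pair scale A B" "cubic_leonard_pair scale B A"
    "cubic_leonard_pair scale B C" "cubic_leonard_pair scale C B"
    "cubic_leonard_pair scale C A" "cubic_leonard_pair scale A C"
proof -
  interpret y: spin_operators scale Y Z X
    by (rule cyclic)
  interpret z: spin_operators scale Z X Y
    by (rule y.cyclic)
  have "leonard_triple scale A B C"
    unfolding A_def B_def C_def by (rule scaled_leonard_triple) fact+
  note pairs = leonard_triple_imp_pairs[OF this]
  note relations = scaled_cubic_relations[OF assms(1)] y.scaled_cubic_relations[OF assms(2)]
    z.scaled_cubic_relations[OF assms(3)]
  show "cubic_leonard_pair scale A B" "cubic_leonard_pair scale B A"
    "cubic_leonard_pair scale B C" "cubic_leonard_pair scale C B"
    "cubic_leonard_pair scale C A" "cubic_leonard_pair scale A C"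
    using pairs relations unfolding A_def B_def C_def
    by (simp_all add: cubic_leonard_pair_def cubic_leonard_pair_axioms_def vector_space_axioms)
qed

end

section \<open>From modules to triples of operators\<close>

lemma single_in_generated:
  fixes P :: "'k::field spin_alg \<Rightarrow> bool"
  assumes scalar: "\<And>c. P (scalar c)" and gens: "P x_gen" "P y_gen" "P z_gen"
    and mult: "\<And>a b. P a \<Longrightarrow> P b \<Longrightarrow> P (a * b)"
  shows "P (abs_spin_alg (Poly_Mapping.single (Word l) c))"
proof (induction l arbitrary: c)
  case Nil
  show ?case
    using scalar[of c] by (simp add: scalar.abs_eq zero_word_def)
next
  case (Cons g l)
  have "P (abs_spin_alg (fgen g))"
    using gens by (cases g) (simp_all add: x_gen.abs_eq y_gen.abs_eq z_gen.abs_eq)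
  moreover have "Poly_Mapping.single (Word (g # l)) c = fgen g * Poly_Mapping.single (Word l) c"
    by (simp add: mult_single plus_word_def)
  ultimately show ?case
    using mult Cons by (simp add: times_spin_alg.abs_eq[symmetric])
qed

text \<open>Elements are sums of scalar multiples of words. This shows that a subspace stable under
  the three generators is a submodule, so irreducibility passes to the operators.\<close>

lemma spin_alg_induct:
  fixes P :: "'k::field spin_alg \<Rightarrow> bool"
  assumes scalar: "\<And>c. P (scalar c)" and gens: "P x_gen" "P y_gen" "P z_gen"
    and add: "\<And>a b. P a \<Longrightarrow> P b \<Longrightarrow> P (a + b)" and mult: "\<And>a b. P a \<Longrightarrow> P b \<Longrightarrow> P (a * b)"
  shows "P a"
proof -
  have "P (abs_spin_alg f)" for f
  proof (induction f rule: update_induct)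
    case const
    show ?case
      using scalar[of 0] by (simp add: scalar.abs_eq)
  next
    case (update f u c)
    have "Poly_Mapping.update u c f = f + Poly_Mapping.single u c"
      using update.hyps(1)
      by (intro poly_mapping_eqI) (auto simp: lookup_update lookup_add lookup_single in_keys_iff when_def)
    moreover have "P (abs_spin_alg (Poly_Mapping.single u c))"
      using single_in_generated[OF scalar gens mult] by (cases u) auto
    ultimately show ?case
      using add update.IH by (simp add: plus_spin_alg.abs_eq[symmetric])
  qed
  then show ?thesis
    by (rule spin_alg.abs_induct)
qed

context spin_module
begin

lemma act_two: "act (2 * a) v = act a v + act a v"
  unfolding mult_2 by (rule act_add)

lemma act_relations:
  shows "act x_gen (act y_gen v) + act y_gen (act x_gen v) = act z_gen v + act z_gen v"
    and "act y_gen (act z_gen v) + act z_gen (act y_gen v) = act x_gen v + act x_gen v"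
    and "act z_gen (act x_gen v) + act x_gen (act z_gen v) = act y_gen v + act y_gen v"
  by (simp_all only: act_two[symmetric] act_add[symmetric] act_mult[symmetric] spin_alg_relations)

end

lemma spin_operators_of_module:
  fixes scale :: "'k::{alg_closed_field, field_char_0} \<Rightarrow> 'v::ab_group_add \<Rightarrow> 'v"
  assumes "spin_module scale act" and fin: "spin_module.fin_dim scale"
    and irr: "spin_module.irreducible_module scale act"
  shows "spin_operators scale (act x_gen) (act y_gen) (act z_gen)"
proof -
  interpret spin_module scale act
    by fact
  \<comment> \<open>The 2 in the algebra relations is the ring element \<open>1 + 1\<close>; here it
    is matched with the field scalar.\<close>
  have double: "scale 2 v = v + v" for v
    using scale_left_distrib[of 1 1 v] by simp
  show ?thesis
  proof (intro spin_operators.intro spin_operators_axioms.intro)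
    show "\<exists>B. finite B \<and> span B = UNIV"
      using fin by (simp add: fin_dim_def)
    show "(UNIV :: 'v set) \<noteq> {0}"
      using irr by (simp add: irreducible_module_def)
  next
    fix W assume W: "subspace W"
      and inv: "\<And>w. w \<in> W \<Longrightarrow> act x_gen w \<in> W \<and> act y_gen w \<in> W \<and> act z_gen w \<in> W"
    have "\<forall>w\<in>W. act a w \<in> W" for a
      by (induction a rule: spin_alg_induct)
        (use inv W in \<open>auto simp: act_scalar act_add act_mult intro: subspace_scale subspace_add\<close>)
    then show "W = {0} \<or> W = UNIV"
      using irr W by (simp add: irreducible_module_def submodule_def)
  qed (simp_all add: act_linear act_relations double vector_space_axioms)
qed

section \<open>Traces of the generators in the explicit bases\<close>

lemma alternating_even_sum:
  assumes "even d"
  shows "(\<Sum>i\<le>d. (-1) ^ i * (of_nat d - 2 * of_nat i)) = (0 :: 'k::field_char_0)" (is "?s = 0")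
proof -
  \<comment> \<open>Replacing \<open>i\<close> by \<open>d - i\<close> negates every term, the sign
    \<open>(-1) ^ i\<close> being kept because \<open>d\<close> is even.\<close>
  have "?s = (\<Sum>i\<le>d. (-1) ^ (d - i) * (of_nat d - 2 * of_nat (d - i)))"
    by (rule sum.nat_diff_reindex[of _ "Suc d", symmetric, simplified lessThan_Suc_atMost, simplified])
  also have "\<dots> = (\<Sum>i\<le>d. - ((-1) ^ i * (of_nat d - 2 * of_nat i)))"
    using assms by (intro sum.cong) (simp_all add: minus_one_power_iff of_nat_diff algebra_simps)
  also have "\<dots> = - ?s"
    by (rule sum_negf)
  finally show ?thesis
    by simp
qed

lemma alternating_odd_sum:
  "(\<Sum>i\<le>d. (-1) ^ (d + i) * (2 * of_nat d - 2 * of_nat i + 1)) = ((-1) ^ d * (of_nat d + 1) :: 'k::field_char_0)"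
proof (induction d)
  case (Suc d)
  \<comment> \<open>Once the term at 0 is split off, shifting the index by one gives exactly the sum
    for \<open>d\<close>.\<close>
  have shift: "(\<Sum>i\<le>Suc d. (-1) ^ (Suc d + i) * (2 * of_nat (Suc d) - 2 * of_nat i + 1)) =
      (-1) ^ Suc d * (2 * of_nat d + 3) +
      (\<Sum>i\<le>d. (-1) ^ (d + i) * (2 * of_nat d - 2 * of_nat i + 1 :: 'k))"
    by (subst sum.atMost_Suc_shift) (simp add: algebra_simps)
  show ?case
    unfolding shift Suc.IH by (simp add: algebra_simps)
qed simp

context vector_space
begin

lemma coord_pred_vec: "ordered_basis scale d v \<Longrightarrow> i \<le> d \<Longrightarrow> coord scale d v (pred_vec v i) i = 0"
  by (cases i) (simp_all add: pred_vec_def coord_zero coord_basis)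

lemma coord_succ_vec_zero:
  "ordered_basis scale d v \<Longrightarrow> i \<le> d \<Longrightarrow> coord scale d v (succ_vec d 0 v i) i = 0"
  by (simp add: succ_vec_def coord_basis coord_zero)

lemma coord_succ_vec_last:
  "ordered_basis scale d v \<Longrightarrow> i \<le> d \<Longrightarrow>
    coord scale d v (succ_vec d (v d) v i) i = (if i = d then 1 else 0)"
  by (simp add: succ_vec_def coord_basis)

end

text \<open>\<open>y\<close> and \<open>z\<close> send each \<open>v i\<close> to its neighbours
  only, so their diagonals vanish; for \<open>x\<close> the eigenvalues cancel in pairs.\<close>

lemma type_B_traces:
  fixes scale :: "'k::field_char_0 \<Rightarrow> 'v::ab_group_add \<Rightarrow> 'v"
  assumes "spin_module scale act" and "spin_module.type_B scale act"
  shows "\<exists>d v. ordered_basis scale d v \<and>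
    (\<forall>g\<in>{x_gen, y_gen, z_gen}. (\<Sum>i\<le>d. matrix_wrt scale d v (act g) i i) = 0)"
proof -
  interpret spin_module scale act
    by fact
  obtain d v where d: "even d" and v: "ordered_basis scale d v"
    and act: "\<forall>i\<le>d.
          act x_gen (v i) = scale ((-1) ^ i * (of_nat d - 2 * of_nat i)) (v i) \<and>
          act y_gen (v i) =
            scale (of_nat d - of_nat i + 1) (pred_vec v i) +
            scale (of_nat i + 1) (succ_vec d 0 v i) \<and>
          act z_gen (v i) =
            scale ((-1) ^ (i + 1) * (of_nat d - of_nat i + 1)) (pred_vec v i) +
            scale ((-1) ^ i * (of_nat i + 1)) (succ_vec d 0 v i)"
    using assms(2) unfolding type_B_def type_Bd_def by blast
  note coords = coord_add[OF v] coord_scale[OF v] coord_pred_vec[OF v] coord_succ_vec_zero[OF v]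
    coord_basis[OF v]
  have "(\<Sum>i\<le>d. matrix_wrt scale d v (act x_gen) i i) = 0"
    using alternating_even_sum[OF d, where 'k = 'k] act by (simp add: matrix_wrt_eq_coord coords)
  moreover have "(\<Sum>i\<le>d. matrix_wrt scale d v (act y_gen) i i) = 0"
    "(\<Sum>i\<le>d. matrix_wrt scale d v (act z_gen) i i) = 0"
    using act by (simp_all add: matrix_wrt_eq_coord coords del: scale_minus_left mult_minus_left power_Suc)
  ultimately show ?thesis
    using v by blast
qed

text \<open>The convention that \<open>v d\<close> stands for the vector after the last gives
  \<open>y\<close> and \<open>z\<close> a single diagonal entry, at \<open>d\<close>. All three
  traces are \<open>d + 1\<close> up to sign, hence nonzero in characteristic zero.\<close>

lemma type_AB_traces:
  fixes scale :: "'k::field_char_0 \<Rightarrow> 'v::ab_group_add \<Rightarrow> 'v"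
  assumes "spin_module scale act" and "spin_module.type_AB scale act"
  shows "\<exists>d v. ordered_basis scale d v \<and>
    (\<forall>g\<in>{x_gen, y_gen, z_gen}. (\<Sum>i\<le>d. matrix_wrt scale d v (act g) i i) \<noteq> 0)"
proof -
  interpret spin_module scale act
    by fact
  obtain d n v where v: "ordered_basis scale d v"
    and act: "\<forall>i\<le>d.
          act x_gen (v i) =
            scale (hat_sign GX n * (-1) ^ (d + i) * (2 * of_nat d - 2 * of_nat i + 1)) (v i) \<and>
          act y_gen (v i) =
            scale (hat_sign GY n * (-1) ^ d)
              (scale (2 * of_nat d - of_nat i + 2) (pred_vec v i) +
               scale (of_nat i + 1) (succ_vec d (v d) v i)) \<and>
          act z_gen (v i) =
            scale (hat_sign GZ n)
              (scale ((-1) ^ (i + 1) * (2 * of_nat d - of_nat i + 2)) (pred_vec v i) +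
               scale ((-1) ^ i * (of_nat i + 1)) (succ_vec d (v d) v i))"
    using assms(2) unfolding type_AB_def type_ABdn_def by blast
  note coords = coord_add[OF v] coord_scale[OF v] coord_pred_vec[OF v] coord_succ_vec_last[OF v]
    coord_basis[OF v]
  have nonzero: "hat_sign g n * ((-1) ^ d * (of_nat d + 1)) \<noteq> (0 :: 'k)" for g
    using of_nat_neq_0[of d, where 'a = 'k] by (simp add: hat_sign_def add.commute)
  have "(\<Sum>i\<le>d. matrix_wrt scale d v (act x_gen) i i) =
      hat_sign GX n * (\<Sum>i\<le>d. (-1) ^ (d + i) * (2 * of_nat d - 2 * of_nat i + 1))"
    using act by (simp add: matrix_wrt_eq_coord coords sum_distrib_left mult.assoc)
  moreover have "(\<Sum>i\<le>d. matrix_wrt scale d v (act y_gen) i i) =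
      (\<Sum>i\<le>d. if i = d then hat_sign GY n * ((-1) ^ d * (of_nat d + 1)) else 0)"
    "(\<Sum>i\<le>d. matrix_wrt scale d v (act z_gen) i i) =
      (\<Sum>i\<le>d. if i = d then hat_sign GZ n * ((-1) ^ d * (of_nat d + 1)) else 0)"
    using act
    by (intro sum.cong; simp add: matrix_wrt_eq_coord coords del: scale_minus_left mult_minus_left)+
  ultimately show ?thesis
    using nonzero v by (intro exI[of _ d] exI[of _ v]) (simp add: alternating_odd_sum)
qed

theorem theorem9p4:
  fixes scale :: "'k::{alg_closed_field, field_char_0} \<Rightarrow> 'v::ab_group_add \<Rightarrow> 'v"
    and act :: "'k spin_alg \<Rightarrow> 'v \<Rightarrow> 'v"
    and \<xi> \<xi>s \<xi>e :: 'k
    and A As Ae :: "'v \<Rightarrow> 'v"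
  assumes "spin_module scale act"
    and "spin_module.fin_dim scale"
    and "spin_module.irreducible_module scale act"
    and "\<xi> \<noteq> 0" and "\<xi>s \<noteq> 0" and "\<xi>e \<noteq> 0"
    and "A = act (scalar \<xi> * x_gen)"
    and "As = act (scalar \<xi>s * y_gen)"
    and "Ae = act (scalar \<xi>e * z_gen)"
  shows "leonard_triple scale A As Ae \<and>
    bannai_ito_triple scale A As Ae \<and>
    (spin_module.type_B scale act \<longrightarrow> totally_bipartite scale A As Ae) \<and>
    (spin_module.type_AB scale act \<longrightarrow> totally_almost_bipartite scale A As Ae)"
proof -
  interpret spin_module scale act
    by fact
  interpret spin_operators scale "act x_gen" "act y_gen" "act z_gen"
    using assms(1-3) by (rule spin_operators_of_module)
  have A: "A = (\<lambda>v. scale \<xi> (act x_gen v))" "As = (\<lambda>v. scale \<xi>s (act y_gen v))"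
    "Ae = (\<lambda>v. scale \<xi>e (act z_gen v))"
    using assms(7-9) by (auto simp: act_mult act_scalar)
  have triple: "leonard_triple scale A As Ae"
    unfolding A using assms(4-6) by (rule scaled_leonard_triple)
  note pairs = scaled_cubic_pairs[OF assms(4-6), folded A]
  \<comment> \<open>As the scalars are nonzero, rescaling does not affect whether a trace
    vanishes.\<close>
  have traces: "(\<Sum>i\<le>d. matrix_wrt scale d v A i i) = \<xi> * (\<Sum>i\<le>d. matrix_wrt scale d v (act x_gen) i i)"
    "(\<Sum>i\<le>d. matrix_wrt scale d v As i i) = \<xi>s * (\<Sum>i\<le>d. matrix_wrt scale d v (act y_gen) i i)"
    "(\<Sum>i\<le>d. matrix_wrt scale d v Ae i i) = \<xi>e * (\<Sum>i\<le>d. matrix_wrt scale d v (act z_gen) i i)"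
    if "ordered_basis scale d v" for d v
    by (simp_all add: A matrix_wrt_scaled[OF that] sum_distrib_left)
  have "bannai_ito_triple scale A As Ae"
    unfolding bannai_ito_triple_def using triple pairs by (simp add: bannai_ito_pairI)
  moreover have "all_tridiagonals scale bipartite_matrix A As Ae" if B: type_B
  proof -
    obtain d v where "ordered_basis scale d v"
      and "\<And>g. g \<in> {x_gen, y_gen, z_gen} \<Longrightarrow> (\<Sum>i\<le>d. matrix_wrt scale d v (act g) i i) = 0"
      using type_B_traces[OF assms(1) B] by blast
    then show ?thesis
      using traces by (intro all_tridiagonalsI(1)[OF pairs]) auto
  qed
  moreover have "all_tridiagonals scale almost_bipartite_matrix A As Ae" if AB: type_AB
  proof -
    obtain d v where "ordered_basis scale d v"
      and "\<And>g. g \<in> {x_gen, y_gen, z_gen} \<Longrightarrow> (\<Sum>i\<le>d. matrix_wrt scale d v (act g) i i) \<noteq> 0"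
      using type_AB_traces[OF assms(1) AB] by blast
    then show ?thesis
      using traces assms(4-6) by (intro all_tridiagonalsI(2)[OF pairs]) auto
  qed
  ultimately show ?thesis
    using triple by (simp add: totally_bipartite_def totally_almost_bipartite_def)
qed

end
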